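(* Let $n\geq 3$ and let $1\leq k\leq n-3$. Then there exist $r>0$, a smooth positive function $f$ on $B_r\subset\mathbb{R}^n$, and a convex viscosity solution $u$ of $$\frac{\sigma_n(D^2u)}{\sigma_k(D^2u)}=f(x)\quad\text{in } B_r$$ such that $u\in C^{0,1}(B_r)$ but $u\notin C^{1,\beta}(B_{r/2})$ for any $\beta>1-\frac{2}{n-k}$.
   Context: $B_r\subset\mathbb{R}^n$ is the open ball of radius $r$ centered at the origin. For a symmetric $n\times n$ matrix $A$, $\sigma_j(A)$ is the $j$-th elementary symmetric polynomial of the eigenvalues of $A$. Viscosity solution is in the usual sense for this equation (elliptic on positive definite matrices): a convex function $u$ is a viscosity solution in $B_r$ if (i) whenever $\varphi\in C^2$ and $u-\varphi$ has a local maximum at $x_0\in B_r$, one has $D^2\varphi(x_0)>0$ and $\frac{\sigma_n}{\sigma_k}(D^2\varphi(x_0))\geq f(x_0)$; and (ii) whenever $\varphi\in C^2$, $u-\varphi$ has a local minimum at $x_0\in B_r$ and $D^2\varphi(x_0)>0$, one has $\frac{\sigma_n}{\sigma_k}(D^2\varphi(x_0))\leq f(x_0)$. *)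

theory Defs
  imports "HOL-Analysis.Analysis" "HOL-Computational_Algebra.Polynomial"
begin

definition char_polynomial :: "real ^ 'n ^ 'n \<Rightarrow> real poly" where
  "char_polynomial A = det (mat [:0, 1:] - (\<chi> i j. [:A $ i $ j:]))"

(* The real eigenvalues with algebraic multiplicity, in increasing order. For symmetric A
   the characteristic polynomial splits over the reals, so the list has length CARD('n). *)
definition eigenvalues :: "real ^ 'n ^ 'n \<Rightarrow> real list" where
  "eigenvalues A = sorted_list_of_multiset (proots (char_polynomial A))"

definition elem_sym :: "nat \<Rightarrow> real list \<Rightarrow> real" where
  "elem_sym j xs = (\<Sum>I | I \<subseteq> {..<length xs} \<and> card I = j. \<Prod>i\<in>I. xs ! i)"

definition sigma :: "nat \<Rightarrow> real ^ 'n ^ 'n \<Rightarrow> real" where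
  "sigma j A = elem_sym j (eigenvalues A)"

(* Only applied to Hessians of C^2 functions, which are symmetric. *)
definition positive_definite :: "real ^ 'n ^ 'n \<Rightarrow> bool" where
  "positive_definite A \<longleftrightarrow> (\<forall>v. v \<noteq> 0 \<longrightarrow> v \<bullet> (A *v v) > 0)"

definition partial_deriv :: "'n \<Rightarrow> (real ^ 'n \<Rightarrow> real) \<Rightarrow> real ^ 'n \<Rightarrow> real" where
  "partial_deriv i f x = frechet_derivative f (at x) (axis i 1)"

definition hessian :: "(real ^ 'n \<Rightarrow> real) \<Rightarrow> real ^ 'n \<Rightarrow> real ^ 'n ^ 'n" where
  "hessian f x = (\<chi> i j. partial_deriv i (partial_deriv j f) x)"

(* The class C^m; meant for open S, where differentiability "at x" only depends on
   the values of f on S. *)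
primrec Ck_on :: "nat \<Rightarrow> (real ^ 'n) set \<Rightarrow> (real ^ 'n \<Rightarrow> real) \<Rightarrow> bool" where
  "Ck_on 0 S f \<longleftrightarrow> continuous_on S f"
| "Ck_on (Suc m) S f \<longleftrightarrow>
     (\<forall>x\<in>S. f differentiable (at x)) \<and> (\<forall>i. Ck_on m S (partial_deriv i f))"

definition smooth_on :: "(real ^ 'n) set \<Rightarrow> (real ^ 'n \<Rightarrow> real) \<Rightarrow> bool" where
  "smooth_on S f \<longleftrightarrow> (\<forall>m. Ck_on m S f)"

definition local_max_at :: "(real ^ 'n \<Rightarrow> real) \<Rightarrow> real ^ 'n \<Rightarrow> bool" where
  "local_max_at g x \<longleftrightarrow> (\<forall>\<^sub>F y in nhds x. g y \<le> g x)"

definition local_min_at :: "(real ^ 'n \<Rightarrow> real) \<Rightarrow> real ^ 'n \<Rightarrow> bool" where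
  "local_min_at g x \<longleftrightarrow> (\<forall>\<^sub>F y in nhds x. g x \<le> g y)"

(* Viscosity solutions in the open set S of sigma_n (D^2 u) / sigma_k (D^2 u) = f,
   for convex u, with n = CARD('n). *)
definition viscosity_solution ::
  "nat \<Rightarrow> (real ^ 'n \<Rightarrow> real) \<Rightarrow> (real ^ 'n) set \<Rightarrow> (real ^ 'n \<Rightarrow> real) \<Rightarrow> bool" where
  "viscosity_solution k f S u \<longleftrightarrow>
     (\<forall>\<phi>. Ck_on 2 S \<phi> \<longrightarrow> (\<forall>x0\<in>S.
        (local_max_at (\<lambda>x. u x - \<phi> x) x0 \<longrightarrow>
           positive_definite (hessian \<phi> x0) \<and>
           sigma CARD('n) (hessian \<phi> x0) / sigma k (hessian \<phi> x0) \<ge> f x0) \<and>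
        (local_min_at (\<lambda>x. u x - \<phi> x) x0 \<and> positive_definite (hessian \<phi> x0) \<longrightarrow>
           sigma CARD('n) (hessian \<phi> x0) / sigma k (hessian \<phi> x0) \<le> f x0)))"

definition C01_on :: "(real ^ 'n) set \<Rightarrow> (real ^ 'n \<Rightarrow> real) \<Rightarrow> bool" where
  "C01_on S u \<longleftrightarrow> (\<exists>L. L-lipschitz_on S u)"

(* The class C^{1,beta}, beta > 0, for a bounded convex open set S: the Hoelder condition
   on the gradient G then implies that G is continuous and that u and G are bounded. *)
definition C1_holder_on :: "real \<Rightarrow> (real ^ 'n) set \<Rightarrow> (real ^ 'n \<Rightarrow> real) \<Rightarrow> bool" where
  "C1_holder_on \<beta> S u \<longleftrightarrow>
     (\<exists>G C. (\<forall>x\<in>S. GDERIV u x :> G x) \<and>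
            (\<forall>x\<in>S. \<forall>y\<in>S. norm (G x - G y) \<le> C * norm (x - y) powr \<beta>))"

end

theory Submission
  imports Defs
begin

text \<open>
Split off one coordinate \<open>\<tau> = x $ t\<close>, let \<open>x'\<close> be the remaining part of \<open>x\<close>, and put
\<open>\<rho> = |x'|\<close>, \<open>m = n - k \<ge> 3\<close>, \<open>\<alpha> = 2 - 2/m\<close> (so \<open>1 < \<alpha> < 2\<close>) and \<open>h = 1 - \<tau>\<^sup>2\<close>. The solution is the
Pogorelov-type function \<open>u = \<rho>\<^sup>\<alpha> h\<^bsup>1-\<alpha>\<^esup>\<close>, considered on the ball of radius 1/2.

The exponent is dictated by scaling. Near the axis \<open>\<rho> = 0\<close> the Hessian of \<open>u\<close> has \<open>n - 1\<close> eigenvalues of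
size \<open>\<rho>\<^bsup>\<alpha>-2\<^esup>\<close> and one of size \<open>\<rho>\<^sup>\<alpha>\<close>, so \<open>\<sigma>\<^sub>n / \<sigma>\<^sub>k\<close> has the size \<open>\<rho>\<close> to the power
\<open>(\<alpha> - 2)(m - 1) + \<alpha> = \<alpha> m - 2(m - 1) = 0\<close>. More precisely \<open>D\<^sup>2u = \<lambda> K\<close>, where \<open>\<lambda> = \<alpha> \<rho>\<^bsup>\<alpha>-2\<^esup> h\<^bsup>1-\<alpha>\<^esup>\<close> and
\<open>K\<close> is the identity plus a symmetric matrix acting on the plane of \<open>x'\<close> and the axis. Hence \<open>\<sigma>\<^sub>j(K)\<close> is
explicit, a polynomial in \<open>\<rho>\<^sup>2\<close>, \<open>\<tau>\<close> and \<open>1/h\<close>, the determinant of \<open>K\<close> has the factor \<open>\<rho>\<^sup>2\<close>, and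
\<open>\<lambda>\<^sup>m \<rho>\<^sup>2 = \<alpha>\<^sup>m h\<^bsup>2-m\<^esup>\<close>. So \<open>\<sigma>\<^sub>n / \<sigma>\<^sub>k\<close> is a rational function \<open>f\<close> of \<open>\<rho>\<^sup>2\<close> and \<open>\<tau>\<close>, which is smooth and
positive across the axis (\<open>pogorelov_sigma_quotient\<close>, \<open>pogorelov_rhs_smooth\<close>, \<open>pogorelov_rhs_pos\<close>).

Off the axis \<open>u\<close> is smooth. If \<open>\<phi>\<close> touches it there from above, the second derivative test along lines gives
\<open>D\<^sup>2\<phi> \<ge> D\<^sup>2u > 0\<close>, and \<open>\<sigma>\<^sub>n / \<sigma>\<^sub>k\<close> is monotone on positive definite matrices (\<open>sigma_quotient_mono\<close>, from
the monotonicity of the ordered eigenvalues); touching from below is symmetric. On the axis nothing has to be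
compared. No function of class \<open>C\<^sup>2\<close> touches from above, as \<open>u\<close> grows like \<open>\<rho>\<^sup>\<alpha>\<close> with \<open>\<alpha> < 2\<close>; and a function that
touches from below has a local maximum along the axis, where \<open>u = 0\<close>, so its Hessian is not positive definite.

Convexity holds because \<open>u\<close> is the perspective \<open>h (\<rho>/h)\<^sup>\<alpha>\<close> of a power, increasing in the convex function \<open>\<rho>\<close> and
decreasing in the concave function \<open>h\<close>. Finally \<open>u = |s|\<^sup>\<alpha>\<close> on a line through the origin orthogonal to the
axis, so the gradient is not Hoelder continuous with an exponent above \<open>\<alpha> - 1 = 1 - 2/m\<close>.
\<close>

section \<open>Orthonormal eigenbases of symmetric matrices\<close>

definition orthonormal_frame :: "('n \<Rightarrow> real ^ 'n) \<Rightarrow> bool" where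
  "orthonormal_frame b \<longleftrightarrow> (\<forall>i j. b i \<bullet> b j = (if i = j then 1 else 0))"

lemma orthonormal_frame_of_set:
  fixes S :: "(real ^ 'n) set"
  assumes "pairwise orthogonal S" "\<And>x. x \<in> S \<Longrightarrow> norm x = 1" "finite S" "card S = CARD('n)"
  shows "\<exists>b :: 'n \<Rightarrow> real ^ 'n. orthonormal_frame b \<and> bij_betw b UNIV S"
proof -
  obtain b where b: "bij_betw b (UNIV :: 'n set) S"
    using finite_same_card_bij[OF finite_class.finite_UNIV assms(3)] assms(4) by metis
  have "b i \<bullet> b j = (if i = j then 1 else 0)" for i j
  proof (cases "i = j")
    case True
    then show ?thesis using assms(2) b by (metis bij_betwE iso_tuple_UNIV_I norm_eq_1)
  next
    case False
    then have "b i \<noteq> b j" using b by (metis bij_betw_imp_inj_on injD)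
    then show ?thesis using False assms(1) b
      by (metis bij_betwE iso_tuple_UNIV_I orthogonal_def pairwiseD)
  qed
  then show ?thesis using b unfolding orthonormal_frame_def by blast
qed

lemma symmetric_inner_swap:
  fixes A :: "real ^ 'n ^ 'n"
  assumes "transpose A = A"
  shows "x \<bullet> (A *v y) = (A *v x) \<bullet> y"
  by (metis assms dot_lmul_matrix vector_transpose_matrix)

text \<open>For small \<open>e\<close> of the sign of \<open>a\<close> the linear term dominates the quadratic one.\<close>

lemma linear_coefficient_zero:
  fixes a c :: real
  assumes "\<And>e. 2 * e * a + e\<^sup>2 * c \<le> 0"
  shows "a = 0"
proof (rule ccontr)
  assume "a \<noteq> 0"
  \<comment> \<open>With this choice \<open>2 e a = 2 e\<^sup>2 (1 + |c|)\<close>, which exceeds \<open>e\<^sup>2 |c|\<close>.\<close>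
  define e where "e = a / (1 + \<bar>c\<bar>)"
  have "e\<^sup>2 * c \<ge> - (e\<^sup>2 * \<bar>c\<bar>)"
    by (metis abs_ge_minus_self abs_mult abs_power2 minus_le_iff)
  moreover have "2 * e * a = 2 * e\<^sup>2 + 2 * (e\<^sup>2 * \<bar>c\<bar>)"
  proof -
    have "a = e * (1 + \<bar>c\<bar>)" unfolding e_def by (simp add: add_nonneg_eq_0_iff)
    then have "2 * e * a = 2 * e * (e * (1 + \<bar>c\<bar>))" by simp
    then show ?thesis by (simp add: power2_eq_square algebra_simps)
  qed
  moreover have "e\<^sup>2 > 0" using \<open>a \<noteq> 0\<close> unfolding e_def by simp
  moreover have "e\<^sup>2 * \<bar>c\<bar> \<ge> 0" by simp
  ultimately have "2 * e * a + e\<^sup>2 * c > 0" by linarith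
  then show False using assms[of e] by linarith
qed

text \<open>The orthogonal complement \<open>W\<close> of a set of eigenvectors is invariant under the symmetric
matrix \<open>A\<close>. A maximum point \<open>x\<close> of the Rayleigh quotient on the unit sphere of \<open>W\<close> is an
eigenvector, by the first-order condition at \<open>x\<close> in the direction \<open>A x - \<mu> x\<close>, which lies in
\<open>W\<close>.\<close>

lemma eigenvector_orthogonal_to_eigenvectors:
  fixes A :: "real ^ 'n ^ 'n"
  assumes sym: "transpose A = A" and fin: "finite S" and card: "card S < CARD('n)"
    and eig: "\<And>s. s \<in> S \<Longrightarrow> \<exists>d. A *v s = d *\<^sub>R s"
  shows "\<exists>x d. norm x = 1 \<and> (\<forall>s\<in>S. orthogonal x s) \<and> A *v x = d *\<^sub>R x"
proof -
  define W where "W = {x. \<forall>s\<in>S. x \<bullet> s = 0}"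
  have subW: "subspace W" unfolding W_def subspace_def by (auto simp: inner_add_left)
  have clW: "closed W"
  proof -
    have "W = (\<Inter>s\<in>S. {x. s \<bullet> x = 0})" by (auto simp: W_def inner_commute)
    then show ?thesis by (simp add: closed_INT closed_hyperplane)
  qed
  have AW: "A *v x \<in> W" if "x \<in> W" for x
    unfolding W_def
  proof clarify
    fix s assume s: "s \<in> S"
    obtain d where "A *v s = d *\<^sub>R s" using eig[OF s] by blast
    then have "(A *v x) \<bullet> s = d * (x \<bullet> s)"
      using symmetric_inner_swap[OF sym, of x s] by (simp add: inner_commute)
    then show "(A *v x) \<bullet> s = 0" using that s unfolding W_def by auto
  qed
  have "dim S < DIM(real ^ 'n)" using card fin
    by (metis DIM_cart DIM_real dim_le_card le_less_trans mult.right_neutral span_superset)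
  then have "span S \<subset> UNIV" using dim_eq_full[of S] by auto
  then obtain z where z: "z \<noteq> 0" "\<And>y. y \<in> span S \<Longrightarrow> orthogonal z y"
    using orthogonal_to_subspace_exists_gen[of S UNIV] by auto
  then have zW: "z \<in> W" unfolding W_def orthogonal_def by (auto simp: span_base)
  define K where "K = W \<inter> sphere 0 1"
  have "compact K" unfolding K_def by (simp add: clW closed_Int_compact)
  moreover have "z /\<^sub>R norm z \<in> K" using zW z(1) subW
    unfolding K_def by (auto simp: subspace_scale)
  then have "K \<noteq> {}" by auto
  moreover have "continuous_on K (\<lambda>x. x \<bullet> (A *v x))"
    by (intro continuous_intros matrix_vector_mult_linear_continuous_on)
  ultimately obtain x where xK: "x \<in> K" and mx: "\<And>y. y \<in> K \<Longrightarrow> y \<bullet> (A *v y) \<le> x \<bullet> (A *v x)"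
    using continuous_attains_sup[of K "\<lambda>x. x \<bullet> (A *v x)"] by blast
  define \<mu> where "\<mu> = x \<bullet> (A *v x)"
  have xW: "x \<in> W" and nx: "norm x = 1" using xK by (auto simp: K_def)
  have quad: "y \<bullet> (A *v y) \<le> \<mu> * (y \<bullet> y)" if "y \<in> W" for y
  proof (cases "y = 0")
    case True then show ?thesis by simp
  next
    case False
    then have "y /\<^sub>R norm y \<in> K" using that subW unfolding K_def by (auto simp: subspace_scale)
    from mx[OF this] have "inverse (norm y) * (inverse (norm y) * (y \<bullet> (A *v y))) \<le> \<mu>"
      by (simp add: \<mu>_def matrix_vector_mult_scaleR)
    then have "(y \<bullet> (A *v y)) / (norm y)\<^sup>2 \<le> \<mu>"
      by (simp add: divide_inverse power2_eq_square ac_simps)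
    then show ?thesis using False by (simp add: divide_le_eq power2_norm_eq_inner)
  qed
  \<comment> \<open>The direction in which the maximality of \<open>x\<close> is tested.\<close>
  define y where "y = A *v x - \<mu> *\<^sub>R x"
  have yW: "y \<in> W" unfolding y_def by (intro subspace_diff subW AW subspace_scale xW)
  have "y \<bullet> y = 0"
  proof (rule linear_coefficient_zero)
    fix e :: real
    have "x + e *\<^sub>R y \<in> W" by (intro subspace_add subspace_scale subW xW yW)
    from quad[OF this]
    have "x \<bullet> (A *v x) + 2 * e * (y \<bullet> (A *v x)) + e\<^sup>2 * (y \<bullet> (A *v y))
       \<le> \<mu> * (x \<bullet> x) + 2 * e * \<mu> * (y \<bullet> x) + e\<^sup>2 * \<mu> * (y \<bullet> y)"
      using symmetric_inner_swap[OF sym, of x y]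
      by (simp add: matrix_vector_right_distrib matrix_vector_mult_scaleR inner_add_left inner_add_right
          inner_commute power2_eq_square algebra_simps)
    moreover have "x \<bullet> x = 1" using nx by (simp add: norm_eq_1)
    moreover have "y \<bullet> (A *v x) = y \<bullet> y + \<mu> * (y \<bullet> x)"
      using inner_diff_right[of y "A *v x" "\<mu> *\<^sub>R x"] by (simp add: y_def[symmetric])
    ultimately show "2 * e * (y \<bullet> y) + e\<^sup>2 * (y \<bullet> (A *v y) - \<mu> * (y \<bullet> y)) \<le> 0"
      unfolding \<mu>_def[symmetric] by (simp add: algebra_simps)
  qed
  then have "A *v x = \<mu> *\<^sub>R x" by (simp add: y_def)
  moreover have "\<forall>s\<in>S. orthogonal x s" using xW by (simp add: W_def orthogonal_def)
  ultimately show ?thesis using nx by blast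
qed

text \<open>The spectral theorem, in a form that also completes an orthonormal set to an orthonormal
basis: take \<open>A = 0\<close>, for which every vector is an eigenvector.\<close>

lemma extend_orthonormal_eigenvectors:
  fixes A :: "real ^ 'n ^ 'n"
  assumes sym: "transpose A = A"
  shows "finite S \<Longrightarrow> pairwise orthogonal S \<Longrightarrow> (\<And>s. s \<in> S \<Longrightarrow> norm s = 1) \<Longrightarrow>
    (\<And>s. s \<in> S \<Longrightarrow> \<exists>d. A *v s = d *\<^sub>R s) \<Longrightarrow>
    \<exists>b d. orthonormal_frame b \<and> S \<subseteq> range b \<and> (\<forall>i. A *v b i = d i *\<^sub>R b i)"
proof (induction "CARD('n) - card S" arbitrary: S rule: less_induct)
  case less
  show ?case
  proof (cases "card S < CARD('n)")
    case True
    obtain x d where x: "norm x = 1" "\<forall>s\<in>S. orthogonal x s" "A *v x = d *\<^sub>R x"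
      using eigenvector_orthogonal_to_eigenvectors[OF sym less.prems(1) True] less.prems(4) by blast
    have "x \<notin> S" using x by (auto simp: orthogonal_def norm_eq_1)
    then have "CARD('n) - card (insert x S) < CARD('n) - card S" using True less.prems(1) by simp
    then have "\<exists>b d. orthonormal_frame b \<and> insert x S \<subseteq> range b \<and> (\<forall>i. A *v b i = d i *\<^sub>R b i)"
      by (rule less.hyps)
        (use less.prems x in \<open>auto simp: pairwise_insert orthogonal_commute\<close>)
    then show ?thesis by blast
  next
    case False
    have "0 \<notin> S" using less.prems(3) by (metis norm_zero zero_neq_one)
    then have "independent S" by (rule pairwise_orthogonal_independent[OF less.prems(2)])
    then have "card S \<le> CARD('n)" using independent_bound[of S] by simp
    then obtain b :: "'n \<Rightarrow> real ^ 'n" where b: "orthonormal_frame b" "bij_betw b UNIV S"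
      using orthonormal_frame_of_set[OF less.prems(2,3,1)] False by auto
    then have "\<forall>i. \<exists>d. A *v b i = d *\<^sub>R b i" using less.prems(4) by (meson UNIV_I bij_betwE)
    then show ?thesis using b by (metis bij_betw_imp_surj_on order_refl)
  qed
qed

lemma symmetric_orthonormal_eigenbasis:
  fixes A :: "real ^ 'n ^ 'n"
  assumes "transpose A = A"
  shows "\<exists>b d. orthonormal_frame b \<and> (\<forall>i. A *v b i = d i *\<^sub>R b i)"
  using extend_orthonormal_eigenvectors[OF assms, of "{}"] by auto

text \<open>The matrix of \<open>M\<close> in the frame \<open>b\<close> is \<open>Q\<^sup>T M Q\<close> with \<open>Q\<close> orthogonal.\<close>

lemma det_in_orthonormal_frame:
  fixes M :: "real ^ 'n ^ 'n"
  assumes "orthonormal_frame b"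
  shows "det M = det (\<chi> i j. b i \<bullet> (M *v b j))"
proof -
  define Q :: "real ^ 'n ^ 'n" where "Q = (\<chi> i j. b j $ i)"
  have col: "Q *v axis j 1 = b j" for j
    by (simp add: matrix_vector_mult_basis Q_def column_def vec_eq_iff)
  have ent: "(transpose Q ** N ** Q) $ i $ j = b i \<bullet> (N *v b j)" for N i j
  proof -
    have "(transpose Q ** N ** Q) $ i $ j = axis i 1 \<bullet> ((transpose Q ** N ** Q) *v axis j 1)"
      by (simp add: inner_axis' matrix_vector_mult_basis column_def)
    also have "(transpose Q ** N ** Q) *v axis j 1 = transpose Q *v (N *v b j)"
      by (simp add: matrix_vector_mul_assoc[symmetric] col)
    also have "axis i 1 \<bullet> \<dots> = (Q *v axis i 1) \<bullet> (N *v b j)"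
      by (metis dot_lmul_matrix transpose_matrix_vector transpose_transpose)
    finally show ?thesis by (simp add: col)
  qed
  have "transpose Q ** Q = transpose Q ** mat 1 ** Q" by simp
  also have "\<dots> = mat 1"
    using assms unfolding vec_eq_iff ent by (simp add: orthonormal_frame_def) (simp add: mat_def)
  finally have "det Q * det Q = 1" by (metis det_I det_mul det_transpose)
  then have "det M = det (transpose Q ** M ** Q)" by (simp add: det_mul mult.assoc mult.left_commute)
  also have "transpose Q ** M ** Q = (\<chi> i j. b i \<bullet> (M *v b j))"
    unfolding vec_eq_iff ent by simp
  finally show ?thesis .
qed

lemma det_affine_eigenbasis:
  fixes A :: "real ^ 'n ^ 'n"
  assumes "orthonormal_frame b" "\<And>i. A *v b i = d i *\<^sub>R b i"
  shows "det (mat x + s *\<^sub>R A) = (\<Prod>i\<in>UNIV. x + s * d i)"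
proof -
  have "(mat x + s *\<^sub>R A) *v b j = (x + s * d j) *\<^sub>R b j" for j
  proof -
    have "mat x *v b j = x *\<^sub>R b j"
      by (simp add: vec_eq_iff matrix_vector_mult_def mat_def if_distrib[of "\<lambda>z. z * _"] cong: if_cong)
    then show ?thesis
      by (simp add: matrix_vector_mult_add_rdistrib scaleR_matrix_vector_assoc[symmetric] assms(2)
          scaleR_add_left)
  qed
  then show ?thesis
    using assms(1) unfolding orthonormal_frame_def
    by (subst det_in_orthonormal_frame[OF assms(1)], subst det_diagonal) auto
qed

section \<open>Eigenvalues and their elementary symmetric functions\<close>

lemma poly_det: "poly (det B) x = det (\<chi> i j. poly (B $ i $ j) x)"
  for B :: "('a::comm_ring_1) poly ^ 'n ^ 'n"
  by (simp add: det_def poly_sum poly_prod)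

lemma poly_char_polynomial: "poly (char_polynomial A) x = det (mat x - A)"
proof -
  have "(\<chi> i j. poly ((mat [:0, 1:] - (\<chi> i j. [:A $ i $ j:])) $ i $ j) x) = mat x - A"
    by (simp add: vec_eq_iff mat_def)
  then show ?thesis by (simp only: char_polynomial_def poly_det)
qed

text \<open>This identifies the roots of the characteristic polynomial with the diagonal entries in
any orthonormal eigenbasis, multiplicities included; all later statements on \<open>eigenvalues\<close> go
through it.\<close>

lemma mset_eigenvalues:
  fixes A :: "real ^ 'n ^ 'n"
  assumes "orthonormal_frame b" "\<And>i. A *v b i = d i *\<^sub>R b i"
  shows "mset (eigenvalues A) = image_mset d (mset_set UNIV)"
proof -
  have "poly (char_polynomial A) = poly (\<Prod>i\<in>UNIV. [:- d i, 1:])"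
  proof
    fix x
    show "poly (char_polynomial A) x = poly (\<Prod>i\<in>UNIV. [:- d i, 1:]) x"
      using det_affine_eigenbasis[OF assms, where x = x and s = "-1"]
      by (simp add: poly_char_polynomial poly_prod)
  qed
  then have "char_polynomial A = (\<Prod>i\<in>UNIV. [:- d i, 1:])" by (simp add: poly_eq_poly_eq_iff)
  then have "proots (char_polynomial A) = (\<Sum>i\<in>UNIV. proots [:- d i, 1:])"
    by (simp add: proots_prod)
  also have "\<dots> = (\<Sum>i\<in>UNIV. {#d i#})" by simp
  finally show ?thesis unfolding eigenvalues_def
    by (simp add: sum_unfold_sum_mset)
qed

lemma elem_sym_generating_function:
  "(\<Prod>x\<leftarrow>xs. 1 + s * x) = (\<Sum>j\<le>length xs. elem_sym j xs * s ^ j)"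
proof -
  let ?N = "{..<length xs}"
  have "(\<Prod>x\<leftarrow>xs. 1 + s * x) = (\<Prod>i\<in>?N. s * xs ! i + 1)"
    by (simp add: prod.list_conv_set_nth atLeast0LessThan add.commute)
  also have "\<dots> = (\<Sum>I\<in>Pow ?N. (\<Prod>i\<in>I. s * xs ! i))" by (simp add: prod_add)
  also have "\<dots> = (\<Sum>I\<in>Pow ?N. s ^ card I * (\<Prod>i\<in>I. xs ! i))" by (simp add: prod.distrib)
  also have "\<dots> = (\<Sum>j\<le>length xs. \<Sum>I\<in>{I \<in> Pow ?N. card I = j}. s ^ card I * (\<Prod>i\<in>I. xs ! i))"
    by (rule sum.group[symmetric]) (auto dest: card_mono[rotated])
  also have "\<dots> = (\<Sum>j\<le>length xs. elem_sym j xs * s ^ j)"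
    by (intro sum.cong refl) (simp add: elem_sym_def sum_distrib_left sum_distrib_right mult.commute)
  finally show ?thesis .
qed

lemma elem_sym_beyond_length: "length xs < j \<Longrightarrow> elem_sym j xs = 0"
proof -
  assume "length xs < j"
  then have "{I. I \<subseteq> {..<length xs} \<and> card I = j} = {}"
  proof -
    have "card I \<noteq> j" if "I \<subseteq> {..<length xs}" for I
      using card_mono[OF finite_lessThan that] \<open>length xs < j\<close> by simp
    then show ?thesis by blast
  qed
  then show ?thesis by (simp only: elem_sym_def sum.empty)
qed

lemma length_eigenvalues:
  fixes A :: "real ^ 'n ^ 'n"
  assumes "transpose A = A"
  shows "length (eigenvalues A) = CARD('n)"
proof -
  obtain b d where bd: "orthonormal_frame b" "\<And>i. A *v b i = d i *\<^sub>R b i"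
    using symmetric_orthonormal_eigenbasis[OF assms] by blast
  have "size (mset (eigenvalues A)) = CARD('n)" unfolding mset_eigenvalues[OF bd] by simp
  then show ?thesis by simp
qed

text \<open>As \<open>det (1 + s A) = \<Prod> (1 + s \<lambda>\<^sub>i)\<close>, the functions \<open>\<sigma>\<^sub>j(A)\<close> can be read off from a
determinant, without computing any eigenvalue.\<close>

lemma sigma_eq_coeff:
  fixes A :: "real ^ 'n ^ 'n"
  assumes sym: "transpose A = A" and p: "\<And>s. poly p s = det (mat 1 + s *\<^sub>R A)"
  shows "sigma j A = coeff p j"
proof -
  obtain b d where bd: "orthonormal_frame b" "\<And>i. A *v b i = d i *\<^sub>R b i"
    using symmetric_orthonormal_eigenbasis[OF sym] by blast
  let ?xs = "eigenvalues A"
  have "poly p = poly (\<Sum>j\<le>length ?xs. monom (elem_sym j ?xs) j)"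
  proof
    fix s
    have "poly p s = (\<Prod>i\<in>UNIV. 1 + s * d i)" by (simp add: p det_affine_eigenbasis[OF bd])
    also have "\<dots> = prod_mset (image_mset (\<lambda>x. 1 + s * x) (mset ?xs))"
      by (simp add: mset_eigenvalues[OF bd] prod_unfold_prod_mset image_mset.compositionality o_def)
    also have "\<dots> = (\<Prod>x\<leftarrow>?xs. 1 + s * x)" by (simp flip: mset_map add: prod_mset_prod_list)
    finally show "poly p s = poly (\<Sum>j\<le>length ?xs. monom (elem_sym j ?xs) j) s"
      by (simp add: elem_sym_generating_function poly_sum poly_monom)
  qed
  then have "p = (\<Sum>j\<le>length ?xs. monom (elem_sym j ?xs) j)" by (simp add: poly_eq_poly_eq_iff)
  then have "coeff p j = (\<Sum>i\<le>length ?xs. if i = j then elem_sym i ?xs else 0)"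
    by (simp add: coeff_sum)
  then show ?thesis by (simp add: sigma_def elem_sym_beyond_length not_le)
qed

lemma positive_definite_eigenvalues_pos:
  fixes A :: "real ^ 'n ^ 'n"
  assumes "transpose A = A" "positive_definite A" "x \<in> set (eigenvalues A)"
  shows "x > 0"
proof -
  obtain b d where bd: "orthonormal_frame b" "\<And>i. A *v b i = d i *\<^sub>R b i"
    using symmetric_orthonormal_eigenbasis[OF assms(1)] by blast
  have "x \<in># mset (eigenvalues A)" using assms(3) by simp
  then have "x \<in># image_mset d (mset_set UNIV)" unfolding mset_eigenvalues[OF bd] .
  then obtain i where i: "x = d i" by auto
  have "b i \<bullet> b i = 1" using bd by (simp add: orthonormal_frame_def)
  then have "b i \<noteq> 0" by auto
  then have "b i \<bullet> (A *v b i) > 0" using assms(2) by (simp add: positive_definite_def)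
  then show ?thesis using \<open>b i \<bullet> b i = 1\<close> by (simp add: bd i)
qed

section \<open>Monotonicity of eigenvalues and of sigma quotients\<close>

lemma inner_span_orthonormal:
  assumes b: "orthonormal_frame b" and v: "v \<in> span (b ` J)" and i: "i \<notin> J"
  shows "v \<bullet> b i = 0"
proof -
  have "subspace {v. v \<bullet> b i = 0}" by (auto simp: subspace_def inner_add_left)
  moreover have "b ` J \<subseteq> {v. v \<bullet> b i = 0}"
    using b i by (auto simp: orthonormal_frame_def)
  ultimately show ?thesis using v span_minimal by blast
qed

lemma orthonormal_frame_expand:
  fixes b :: "'n \<Rightarrow> real ^ 'n"
  assumes b: "orthonormal_frame b"
  shows "v = (\<Sum>i\<in>UNIV. (v \<bullet> b i) *\<^sub>R b i)" and "independent (b ` J)" and "inj b"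
proof -
  show inj: "inj b"
    using b unfolding orthonormal_frame_def inj_def by (metis zero_neq_one)
  have pw: "pairwise orthogonal (range b)" 
    using b unfolding pairwise_def orthogonal_def orthonormal_frame_def by auto
  have "b i \<noteq> 0" for i using b unfolding orthonormal_frame_def by (metis inner_zero_left zero_neq_one)
  then have nz: "0 \<notin> range b" by auto
  have ind: "independent (range b)" by (rule pairwise_orthogonal_independent[OF pw nz])
  then show "independent (b ` J)" by (meson image_mono independent_mono subset_UNIV)
  have unit: "norm x = 1" if "x \<in> range b" for x
    using that b by (auto simp: orthonormal_frame_def norm_eq_1)
  have "span (range b) = UNIV"
    using ind inj card_eq_dim[of "range b" UNIV] by (simp add: card_image dim_UNIV top.extremum_unique)
  then show "v = (\<Sum>i\<in>UNIV. (v \<bullet> b i) *\<^sub>R b i)"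
    using orthonormal_basis_expand[OF pw, of v] unit inj by (simp add: sum.reindex)
qed

text \<open>If \<open>A \<le> B\<close>, the span of the eigenvectors of \<open>A\<close> to eigenvalues above \<open>t\<close> meets the span
of those of \<open>B\<close> to eigenvalues at most \<open>t\<close> only in 0, since a nonzero vector \<open>v\<close> in both
satisfies \<open>v \<bullet> B v \<le> t |v|\<^sup>2 < v \<bullet> A v\<close>. The dimensions therefore add up to at most \<open>n\<close>.\<close>

lemma eigenvalue_counts:
  fixes A B :: "real ^ 'n ^ 'n"
  assumes A: "orthonormal_frame a" "\<And>i. A *v a i = c i *\<^sub>R a i"
    and B: "orthonormal_frame b" "\<And>i. B *v b i = d i *\<^sub>R b i"
    and le: "\<And>v. v \<bullet> (A *v v) \<le> v \<bullet> (B *v v)"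
  shows "card {i. c i > t} + card {i. d i \<le> t} \<le> CARD('n)"
proof -
  have quad: "v \<bullet> (M *v v) = (\<Sum>i\<in>UNIV. e i * (v \<bullet> f i)\<^sup>2)"
    and sq: "v \<bullet> v = (\<Sum>i\<in>UNIV. (v \<bullet> f i)\<^sup>2)"
    if "orthonormal_frame f" "\<And>i. M *v f i = e i *\<^sub>R f i" for f :: "'n \<Rightarrow> real ^ 'n" and M e v
  proof -
    note ex = orthonormal_frame_expand(1)[OF that(1), of v]
    have "M *v v = M *v (\<Sum>i\<in>UNIV. (v \<bullet> f i) *\<^sub>R f i)" using ex by simp
    also have "\<dots> = (\<Sum>i\<in>UNIV. (v \<bullet> f i) *\<^sub>R (e i *\<^sub>R f i))"
      by (simp add: linear_sum[OF matrix_vector_mul_linear] matrix_vector_mult_scaleR that(2))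
    finally show "v \<bullet> (M *v v) = (\<Sum>i\<in>UNIV. e i * (v \<bullet> f i)\<^sup>2)"
      by (simp add: inner_sum_right power2_eq_square ac_simps)
    have "v \<bullet> v = v \<bullet> (\<Sum>i\<in>UNIV. (v \<bullet> f i) *\<^sub>R f i)" using ex by simp
    then show "v \<bullet> v = (\<Sum>i\<in>UNIV. (v \<bullet> f i)\<^sup>2)"
      by (simp add: inner_sum_right power2_eq_square)
  qed
  let ?V = "span (a ` {i. c i > t})" and ?W = "span (b ` {i. d i \<le> t})"
  have "?V \<inter> ?W \<subseteq> {0}"
  proof (intro subsetI, rule ccontr)
    fix v assume v: "v \<in> ?V \<inter> ?W" and "v \<notin> {0}"
    then have nz: "v \<bullet> v \<noteq> 0" by simp
    have zA: "v \<bullet> a i = 0" if "c i \<le> t" for i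
      using inner_span_orthonormal[OF A(1)] v that by auto
    have zB: "v \<bullet> b i = 0" if "d i > t" for i
      using inner_span_orthonormal[OF B(1)] v that by auto
    have "v \<bullet> (B *v v) \<le> (\<Sum>i\<in>UNIV. t * (v \<bullet> b i)\<^sup>2)"
      unfolding quad[OF B]
    proof (rule sum_mono)
      fix i
      show "d i * (v \<bullet> b i)\<^sup>2 \<le> t * (v \<bullet> b i)\<^sup>2"
        by (cases "d i \<le> t") (auto simp: zB intro: mult_right_mono)
    qed
    also have "\<dots> = t * (v \<bullet> v)" by (simp add: sq[OF B] sum_distrib_left)
    also have "\<dots> = (\<Sum>i\<in>UNIV. t * (v \<bullet> a i)\<^sup>2)" by (simp add: sq[OF A] sum_distrib_left)
    also have "\<dots> < v \<bullet> (A *v v)"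
    proof -
      obtain j where j: "v \<bullet> a j \<noteq> 0"
        using nz unfolding sq[OF A] by fastforce
      then have "c j > t" using zA linorder_not_le by blast
      then have "t * (v \<bullet> a j)\<^sup>2 < c j * (v \<bullet> a j)\<^sup>2" using j by simp
      moreover have "t * (v \<bullet> a i)\<^sup>2 \<le> c i * (v \<bullet> a i)\<^sup>2" for i
        by (cases "c i \<le> t") (auto simp: zA intro: mult_right_mono)
      ultimately show ?thesis unfolding quad[OF A]
        by (intro sum_strict_mono_ex1) auto
    qed
    finally show False using le[of v] by simp
  qed
  then have "dim (?V \<inter> ?W) = 0" by (simp add: dim_eq_0)
  moreover have "dim {x + y |x y. x \<in> ?V \<and> y \<in> ?W} + dim (?V \<inter> ?W) = dim ?V + dim ?W"
    by (rule dim_sums_Int) simp_all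
  moreover have "dim {x + y |x y. x \<in> ?V \<and> y \<in> ?W} \<le> CARD('n)"
    using dim_subset_UNIV[of "{x + y |x y. x \<in> ?V \<and> y \<in> ?W}"] by simp
  moreover have "dim ?V = card {i. c i > t}"
    using orthonormal_frame_expand(2,3)[OF A(1)]
    by (simp add: dim_eq_card_independent card_image inj_on_subset)
  moreover have "dim ?W = card {i. d i \<le> t}"
    using orthonormal_frame_expand(2,3)[OF B(1)]
    by (simp add: dim_eq_card_independent card_image inj_on_subset)
  ultimately show ?thesis by linarith
qed

text \<open>Weyl monotonicity of the ordered eigenvalues. If the entry of index \<open>i\<close> were larger for
\<open>A\<close>, then with \<open>t\<close> the entry for \<open>B\<close> at least \<open>n - i\<close> eigenvalues of \<open>A\<close> exceed \<open>t\<close> and at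
least \<open>i + 1\<close> of \<open>B\<close> do not, one too many for \<open>eigenvalue_counts\<close>.\<close>

lemma eigenvalues_mono:
  fixes A B :: "real ^ 'n ^ 'n"
  assumes symA: "transpose A = A" and symB: "transpose B = B"
    and le: "\<And>v. v \<bullet> (A *v v) \<le> v \<bullet> (B *v v)" and i: "i < CARD('n)"
  shows "eigenvalues A ! i \<le> eigenvalues B ! i"
proof (rule ccontr)
  assume "\<not> ?thesis"
  define t where "t = eigenvalues B ! i"
  with \<open>\<not> ?thesis\<close> have gt: "eigenvalues A ! i > t" by simp
  obtain a c where A: "orthonormal_frame a" "\<And>i. A *v a i = c i *\<^sub>R a i"
    using symmetric_orthonormal_eigenbasis[OF symA] by blast
  obtain b d where B: "orthonormal_frame b" "\<And>i. B *v b i = d i *\<^sub>R b i"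
    using symmetric_orthonormal_eigenbasis[OF symB] by blast
  have cnt: "card {i. P (e i)} = card {j. j < length xs \<and> P (xs ! j)}"
    if "mset xs = image_mset e (mset_set (UNIV :: 'n set))" for xs and e :: "'n \<Rightarrow> real" and P
  proof -
    have "card {i. P (e i)} = size (filter_mset P (mset xs))"
      by (simp add: that filter_mset_image_mset filter_mset_mset_set)
    also have "\<dots> = length (filter P xs)" by (simp flip: mset_filter)
    finally show ?thesis by (simp add: length_filter_conv_card)
  qed
  have sorted: "sorted (eigenvalues M)" for M :: "real ^ 'n ^ 'n"
    by (simp add: eigenvalues_def)
  have "{i..<CARD('n)} \<subseteq> {j. j < length (eigenvalues A) \<and> eigenvalues A ! j > t}"
    using gt sorted_nth_mono[OF sorted[of A], of i] by (fastforce simp: length_eigenvalues[OF symA])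
  then have "CARD('n) - i \<le> card {i. c i > t}"
    using card_mono[of "{j. j < length (eigenvalues A) \<and> eigenvalues A ! j > t}" "{i..<CARD('n)}"]
    by (simp add: cnt[OF mset_eigenvalues[OF A], of "\<lambda>x. t < x"])
  moreover have "{..i} \<subseteq> {j. j < length (eigenvalues B) \<and> eigenvalues B ! j \<le> t}"
    using sorted_nth_mono[OF sorted[of B]] i by (fastforce simp: length_eigenvalues[OF symB] t_def)
  then have "Suc i \<le> card {i. d i \<le> t}"
    using card_mono[of "{j. j < length (eigenvalues B) \<and> eigenvalues B ! j \<le> t}" "{..i}"]
    by (simp add: cnt[OF mset_eigenvalues[OF B], of "\<lambda>x. x \<le> t"])
  ultimately show False using eigenvalue_counts[OF A B le, of t] i by linarith
qed

text \<open>For the reciprocal quotient \<open>\<sigma>\<^sub>j / \<sigma>\<^sub>n\<close> every product cancels, which leaves an elementary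
symmetric function of the reciprocals and makes the monotonicity evident.\<close>

lemma elem_sym_quotient:
  assumes pos: "\<And>x. x \<in> set xs \<Longrightarrow> x > 0" and "j \<le> length xs"
  shows "elem_sym j xs / elem_sym (length xs) xs =
    (\<Sum>I | I \<subseteq> {..<length xs} \<and> card I = j. \<Prod>i\<in>{..<length xs} - I. 1 / xs ! i)"
    and "elem_sym j xs > 0"
proof -
  let ?N = "{..<length xs}"
  have nth: "xs ! i > 0" if "i < length xs" for i using pos that by simp
  have top: "{I. I \<subseteq> ?N \<and> card I = length xs} = {?N}"
    using card_subset_eq[of ?N] by auto
  have fin: "finite {I. I \<subseteq> ?N \<and> card I = j}"
    by (rule finite_subset[of _ "Pow ?N"]) auto
  have "(\<Prod>i\<in>I. xs ! i) / (\<Prod>i\<in>?N. xs ! i) = (\<Prod>i\<in>?N - I. 1 / xs ! i)" if "I \<subseteq> ?N" for I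
  proof -
    have "(\<Prod>i\<in>?N. xs ! i) = (\<Prod>i\<in>?N - I. xs ! i) * (\<Prod>i\<in>I. xs ! i)"
      using that by (simp add: prod.subset_diff)
    moreover have "(\<Prod>i\<in>I. xs ! i) > 0" using that nth by (intro prod_pos) auto
    ultimately show ?thesis by (simp add: prod_dividef)
  qed
  then show "elem_sym j xs / elem_sym (length xs) xs =
    (\<Sum>I | I \<subseteq> ?N \<and> card I = j. \<Prod>i\<in>?N - I. 1 / xs ! i)"
    by (auto simp: elem_sym_def top sum_divide_distrib intro!: sum.cong)
  have "{..<j} \<in> {I. I \<subseteq> ?N \<and> card I = j}" using assms(2) by auto
  then have "{I. I \<subseteq> ?N \<and> card I = j} \<noteq> {}" by blast
  then show "elem_sym j xs > 0" unfolding elem_sym_def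
    by (intro sum_pos fin prod_pos) (auto intro: nth)
qed

lemma sigma_quotient_mono:
  fixes A B :: "real ^ 'n ^ 'n"
  assumes symA: "transpose A = A" and symB: "transpose B = B"
    and posA: "positive_definite A" and le: "\<And>v. v \<bullet> (A *v v) \<le> v \<bullet> (B *v v)"
    and k: "k \<le> CARD('n)"
  shows "sigma CARD('n) A / sigma k A \<le> sigma CARD('n) B / sigma k B"
proof -
  let ?N = "{..<CARD('n)}"
  have posB: "positive_definite B"
    using posA le unfolding positive_definite_def by (meson less_le_trans)
  have pA: "x > 0" if "x \<in> set (eigenvalues A)" for x
    using positive_definite_eigenvalues_pos[OF symA posA that] .
  have pB: "x > 0" if "x \<in> set (eigenvalues B)" for x
    using positive_definite_eigenvalues_pos[OF symB posB that] .
  note lA = length_eigenvalues[OF symA] and lB = length_eigenvalues[OF symB]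
  have nth: "0 < eigenvalues A ! i" "0 < eigenvalues B ! i" if "i < CARD('n)" for i
    using that pA pB lA lB by simp_all
  have "sigma k B / sigma CARD('n) B =
      (\<Sum>I | I \<subseteq> ?N \<and> card I = k. \<Prod>i\<in>?N - I. 1 / eigenvalues B ! i)"
    using elem_sym_quotient(1)[of "eigenvalues B" k, OF pB] k by (simp add: sigma_def lB)
  also have "\<dots> \<le> (\<Sum>I | I \<subseteq> ?N \<and> card I = k. \<Prod>i\<in>?N - I. 1 / eigenvalues A ! i)"
  proof (rule sum_mono, rule prod_mono)
    fix I i assume "i \<in> ?N - I"
    then have "i < CARD('n)" by simp
    then show "0 \<le> 1 / eigenvalues B ! i \<and> 1 / eigenvalues B ! i \<le> 1 / eigenvalues A ! i"
      using nth eigenvalues_mono[OF symA symB le] by (simp add: frac_le less_imp_le)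
  qed
  also have "\<dots> = sigma k A / sigma CARD('n) A"
    using elem_sym_quotient(1)[of "eigenvalues A" k, OF pA] k by (simp add: sigma_def lA)
  finally have "sigma k B / sigma CARD('n) B \<le> sigma k A / sigma CARD('n) A" .
  moreover have "sigma k A > 0" "sigma k B > 0" "sigma CARD('n) A > 0" "sigma CARD('n) B > 0"
    unfolding sigma_def using k
    by (simp_all add: elem_sym_quotient(2) pA pB lA lB)
  ultimately show ?thesis by (simp add: field_simps)
qed

section \<open>Rank-two perturbations of the identity\<close>

text \<open>Only the identity and the transposition of \<open>a\<close> and \<open>c\<close> contribute to the Leibniz sum.\<close>

lemma det_two_by_two_block:
  fixes A :: "real ^ 'n ^ 'n"
  assumes ac: "a \<noteq> c"
    and diag: "\<And>i. i \<noteq> a \<Longrightarrow> i \<noteq> c \<Longrightarrow> A $ i $ i = d"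
    and off: "\<And>i j. i \<noteq> j \<Longrightarrow> (i, j) \<noteq> (a, c) \<Longrightarrow> (i, j) \<noteq> (c, a) \<Longrightarrow> A $ i $ j = 0"
  shows "det A = d ^ (CARD('n) - 2) * (A $ a $ a * A $ c $ c - A $ a $ c * A $ c $ a)"
proof -
  let ?t = "Transposition.transpose a c"
  let ?term = "\<lambda>p. of_int (sign p) * (\<Prod>i\<in>UNIV. A $ i $ p i)"
  have split: "(\<Prod>i\<in>UNIV. g i) = g a * g c * (\<Prod>i\<in>UNIV - {a, c}. g i)" for g :: "'n \<Rightarrow> real"
  proof -
    have "(\<Prod>i\<in>UNIV. g i) = g a * (g c * (\<Prod>i\<in>UNIV - {a} - {c}. g i))"
      using ac prod.remove[of UNIV a g] prod.remove[of "UNIV - {a}" c g] by simp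
    moreover have "UNIV - {a} - {c} = UNIV - {a, c}" by auto
    ultimately show ?thesis by simp
  qed
  have card: "card (UNIV - {a, c}) = CARD('n) - 2" using ac by (simp add: card_Diff_subset)
  have "det A = (\<Sum>p\<in>{id, ?t}. ?term p)"
    unfolding det_def
  proof (rule sum.mono_neutral_right)
    show "finite {p. p permutes (UNIV :: 'n set)}" by (simp add: finite_permutations)
    show "{id, ?t} \<subseteq> {p. p permutes UNIV}" by (auto simp: permutes_id permutes_swap_id)
    show "\<forall>p\<in>{p. p permutes UNIV} - {id, ?t}. ?term p = 0"
    proof
      fix p assume p: "p \<in> {p. p permutes UNIV} - {id, ?t}"
      then have "\<not> p permutes {a, c}" by (simp add: permutes_doubleton_iff)
      then obtain i where i: "i \<noteq> a" "i \<noteq> c" "p i \<noteq> i"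
        using p permutes_superset[of p UNIV "{a, c}"] by auto
      then have "A $ i $ p i = 0" by (intro off) auto
      then have "(\<Prod>i\<in>UNIV. A $ i $ p i) = 0" by (intro prod_zero) auto
      then show "?term p = 0" by simp
    qed
  qed
  also have "\<dots> = ?term id + ?term ?t"
  proof -
    have "id a \<noteq> ?t a" using ac by simp
    then have "id \<notin> {?t}" by (metis singletonD)
    then show ?thesis by (subst sum.insert) simp_all
  qed
  also have "?term id = d ^ (CARD('n) - 2) * (A $ a $ a * A $ c $ c)"
    using diag by (simp add: split card)
  also have "?term ?t = - (d ^ (CARD('n) - 2) * (A $ a $ c * A $ c $ a))"
    using diag ac by (simp add: split card sign_swap_id transpose_def)
  finally show ?thesis by (simp add: algebra_simps)
qed

text \<open>This is \<open>1 + p y y\<^sup>T + q (y e\<^sup>T + e y\<^sup>T) + r e e\<^sup>T\<close>. Up to a scalar the Hessian of the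
solution has this form, with \<open>e\<close> the direction of the axis and \<open>y\<close> orthogonal to it.\<close>

definition rank_two_perturbation ::
    "real ^ 'n \<Rightarrow> real ^ 'n \<Rightarrow> real \<Rightarrow> real \<Rightarrow> real \<Rightarrow> real ^ 'n ^ 'n" where
  "rank_two_perturbation y e p q r = (\<chi> i j. (if i = j then 1 else 0) + p * y $ i * y $ j
     + q * (y $ i * e $ j + e $ i * y $ j) + r * e $ i * e $ j)"

lemma rank_two_perturbation_mult:
  "rank_two_perturbation y e p q r *v v =
    v + (p * (y \<bullet> v) + q * (e \<bullet> v)) *\<^sub>R y + (q * (y \<bullet> v) + r * (e \<bullet> v)) *\<^sub>R e"
proof -
  have "(rank_two_perturbation y e p q r *v v) $ i =
      (\<Sum>j\<in>UNIV. (if i = j then v $ j else 0) + (p * y $ i) * (y $ j * v $ j)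
        + (q * y $ i) * (e $ j * v $ j) + (q * e $ i) * (y $ j * v $ j) + (r * e $ i) * (e $ j * v $ j))" for i
    unfolding rank_two_perturbation_def matrix_vector_mult_def vec_lambda_beta
    by (intro sum.cong refl) (simp add: algebra_simps)
  then have "(rank_two_perturbation y e p q r *v v) $ i =
      v $ i + (p * y $ i) * (y \<bullet> v) + (q * y $ i) * (e \<bullet> v) + (q * e $ i) * (y \<bullet> v) + (r * e $ i) * (e \<bullet> v)" for i
    by (simp only: sum.distrib sum_distrib_left[symmetric] inner_vec_def inner_real_def) simp
  then show ?thesis by (simp add: vec_eq_iff algebra_simps)
qed

lemma rank_two_perturbation_symmetric:
  "transpose (rank_two_perturbation y e p q r) = rank_two_perturbation y e p q r"
  by (simp add: transpose_def rank_two_perturbation_def vec_eq_iff algebra_simps)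

lemma rank_two_perturbation_quadratic_form:
  "v \<bullet> (rank_two_perturbation y e p q r *v v) =
    v \<bullet> v + p * (y \<bullet> v)\<^sup>2 + 2 * q * (y \<bullet> v) * (e \<bullet> v) + r * (e \<bullet> v)\<^sup>2"
  unfolding rank_two_perturbation_mult
  by (simp add: inner_add_right inner_commute power2_eq_square algebra_simps)

text \<open>In an orthonormal frame that contains \<open>y / |y|\<close> and \<open>e\<close> the matrix is \<open>1 + s\<close> times the
identity outside the block of these two vectors.\<close>

lemma det_rank_two_perturbation:
  fixes y e :: "real ^ 'n"
  assumes y: "y \<noteq> 0" and e: "norm e = 1" and ye: "y \<bullet> e = 0"
  shows "det (mat 1 + s *\<^sub>R rank_two_perturbation y e p q r) = (1 + s) ^ (CARD('n) - 2) *
    ((1 + s * (1 + p * (y \<bullet> y))) * (1 + s * (1 + r)) - s\<^sup>2 * q\<^sup>2 * (y \<bullet> y))"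
proof -
  let ?K = "rank_two_perturbation y e p q r" and ?R = "norm y"
  define w where "w = y /\<^sub>R ?R"
  have w: "norm w = 1" "w \<bullet> e = 0" and yw: "y = ?R *\<^sub>R w" using y ye by (simp_all add: w_def)
  have "\<exists>b d. orthonormal_frame b \<and> {w, e} \<subseteq> range b \<and> (\<forall>i. (0 :: real ^ 'n ^ 'n) *v b i = d i *\<^sub>R b i)"
  proof (rule extend_orthonormal_eigenvectors)
    show "transpose (0 :: real ^ 'n ^ 'n) = 0" by (simp add: transpose_def vec_eq_iff)
    show "pairwise orthogonal {w, e}" using w by (simp add: pairwise_insert orthogonal_def inner_commute)
    show "\<exists>d. (0 :: real ^ 'n ^ 'n) *v v = d *\<^sub>R v" for v by (intro exI[of _ 0]) simp
  qed (use w e in auto)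
  then obtain b where b: "orthonormal_frame b" and we: "w \<in> range b" "e \<in> range b" by auto
  from we obtain a c where a: "b a = w" and c: "b c = e" by auto
  have "w \<noteq> e" using w e by (metis inner_eq_zero_iff norm_zero zero_neq_one)
  then have ac: "a \<noteq> c" using a c by auto
  have bb: "b i \<bullet> b j = (if i = j then 1 else 0)" for i j using b by (simp add: orthonormal_frame_def)
  have yb: "y \<bullet> b j = (if j = a then ?R else 0)" "b j \<bullet> y = (if j = a then ?R else 0)" for j
    by (subst yw, simp add: bb flip: a)+
  have eb: "e \<bullet> b j = (if j = c then 1 else 0)" "b j \<bullet> e = (if j = c then 1 else 0)" for j
    by (simp_all add: bb flip: c)
  have yy: "y \<bullet> y = norm y * norm y" by (simp add: dot_square_norm power2_eq_square)
  define M :: "real ^ 'n ^ 'n" where "M = (\<chi> i j. b i \<bullet> ((mat 1 + s *\<^sub>R ?K) *v b j))"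
  have M: "M $ i $ j = b i \<bullet> b j + s * (b i \<bullet> b j + (p * (y \<bullet> b j) + q * (e \<bullet> b j)) * (b i \<bullet> y)
      + (q * (y \<bullet> b j) + r * (e \<bullet> b j)) * (b i \<bullet> e))" for i j
    by (simp add: M_def matrix_vector_mult_add_rdistrib scaleR_matrix_vector_assoc[symmetric]
        rank_two_perturbation_mult inner_add_right)
  have "det (mat 1 + s *\<^sub>R ?K) = det M" unfolding M_def by (rule det_in_orthonormal_frame[OF b])
  also have "\<dots> = (1 + s) ^ (CARD('n) - 2) * (M $ a $ a * M $ c $ c - M $ a $ c * M $ c $ a)"
    by (rule det_two_by_two_block[OF ac]) (auto simp: M bb yb eb)
  also have "M $ a $ a = 1 + s * (1 + p * (y \<bullet> y))"
    using ac by (simp add: M bb yb eb yy)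
  also have "M $ c $ c = 1 + s * (1 + r)" using ac by (simp add: M bb yb eb)
  also have "M $ a $ c * M $ c $ a = s\<^sup>2 * q\<^sup>2 * (y \<bullet> y)"
    using ac by (simp add: M bb yb eb yy power2_eq_square)
  finally show ?thesis .
qed

text \<open>By Bessel, \<open>v \<bullet> v \<ge> Y\<^sup>2 / N + E\<^sup>2\<close> for the components \<open>Y = y \<bullet> v\<close> and \<open>E = e \<bullet> v\<close>. What
remains is a binary quadratic form, treated by completing the square.\<close>

lemma positive_definite_rank_two_perturbation:
  fixes y e :: "real ^ 'n"
  assumes y: "y \<noteq> 0" and e: "norm e = 1" and ye: "y \<bullet> e = 0"
    and P: "1 + p * (y \<bullet> y) > 0" and D: "(1 + p * (y \<bullet> y)) * (1 + r) > q\<^sup>2 * (y \<bullet> y)"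
  shows "positive_definite (rank_two_perturbation y e p q r)"
  unfolding positive_definite_def
proof (intro allI impI)
  fix v :: "real ^ 'n" assume v: "v \<noteq> 0"
  define N Y E where "N = y \<bullet> y" and "Y = y \<bullet> v" and "E = e \<bullet> v"
  have N: "N > 0" using y by (simp add: N_def)
  have "0 \<le> (v - (Y / N) *\<^sub>R y - E *\<^sub>R e) \<bullet> (v - (Y / N) *\<^sub>R y - E *\<^sub>R e)" by simp
  also have "\<dots> = v \<bullet> v - Y\<^sup>2 / N - E\<^sup>2"
  proof -
    have "y \<bullet> y = N" "y \<bullet> v = Y" "v \<bullet> y = Y" "e \<bullet> v = E" "v \<bullet> e = E" "y \<bullet> e = 0" "e \<bullet> y = 0" "e \<bullet> e = 1"
      using e ye by (simp_all add: N_def Y_def E_def inner_commute norm_eq_1)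
    then show ?thesis using N
      by (simp add: inner_diff_left inner_diff_right) (simp add: field_simps power2_eq_square)
  qed
  finally have bessel: "v \<bullet> v \<ge> Y\<^sup>2 / N + E\<^sup>2" by simp
  define P' where "P' = 1 + p * N"
  have P': "P' > 0" and D': "P' * (1 + r) > q\<^sup>2 * N" using P D by (simp_all add: P'_def N_def)
  have form: "v \<bullet> (rank_two_perturbation y e p q r *v v) = v \<bullet> v + p * Y\<^sup>2 + 2 * q * Y * E + r * E\<^sup>2"
    by (simp add: rank_two_perturbation_quadratic_form Y_def E_def)
  show "v \<bullet> (rank_two_perturbation y e p q r *v v) > 0"
  proof (cases "Y = 0 \<and> E = 0")
    case True
    then show ?thesis using v by (simp add: form)
  next
    case False
    \<comment> \<open>\<open>P' N\<close> times the binary form, with the square completed in \<open>Y\<close>.\<close>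
    have "(P' * Y + q * N * E)\<^sup>2 + N * (P' * (1 + r) - q\<^sup>2 * N) * E\<^sup>2 > 0"
    proof (cases "E = 0")
      case True
      then show ?thesis using False P' by simp
    next
      case False
      then have "N * (P' * (1 + r) - q\<^sup>2 * N) * E\<^sup>2 > 0" using N D' by simp
      then show ?thesis by (simp add: add_nonneg_pos)
    qed
    also have "(P' * Y + q * N * E)\<^sup>2 + N * (P' * (1 + r) - q\<^sup>2 * N) * E\<^sup>2
        = P' * N * (Y\<^sup>2 / N + E\<^sup>2 + p * Y\<^sup>2 + 2 * q * Y * E + r * E\<^sup>2)"
      using N unfolding P'_def by (simp add: field_simps power2_eq_square)
    finally have "Y\<^sup>2 / N + E\<^sup>2 + p * Y\<^sup>2 + 2 * q * Y * E + r * E\<^sup>2 > 0"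
      by (rule zero_less_mult_pos) (simp add: N P')
    then show ?thesis unfolding form using bessel by linarith
  qed
qed

text \<open>The \<open>j\<close>-th elementary symmetric function of \<open>m\<close> ones and two further numbers with sum \<open>T\<close>
and product \<open>D\<close>.\<close>

definition block_sym :: "nat \<Rightarrow> nat \<Rightarrow> real \<Rightarrow> real \<Rightarrow> real" where
  "block_sym m j T D = real (m choose j) + (if j \<ge> 1 then real (m choose (j - 1)) * T else 0)
     + (if j \<ge> 2 then real (m choose (j - 2)) * D else 0)"

lemma coeff_block_sym: "coeff ([:1, 1:] ^ m * [:1, T, D:]) j = block_sym m j T D"
proof -
  have "[:1, 1:] ^ m * [:1, T, D:] = [:1, 1:] ^ m + smult T (pCons 0 ([:1, 1:] ^ m))
      + smult D (pCons 0 (pCons 0 ([:1, 1:] ^ m)))"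
    by (simp add: mult_pCons_right)
  moreover have "coeff ([:1, 1 :: real:] ^ m) i = real (m choose i)" for i
  proof (cases "i \<le> m")
    case True
    then show ?thesis by (simp add: coeff_linear_poly_power)
  next
    case False
    then have "degree ([:1, 1 :: real:] ^ m) < i" using degree_power_le[of "[:1, 1 :: real:]" m] by simp
    then show ?thesis using False by (simp add: coeff_eq_0 binomial_eq_0)
  qed
  ultimately show ?thesis
    by (cases j; cases "j - 1") (auto simp: block_sym_def coeff_pCons mult.commute split: nat.splits)
qed

lemma sigma_scaled_rank_two_perturbation:
  fixes y e :: "real ^ 'n"
  assumes "y \<noteq> 0" "norm e = 1" "y \<bullet> e = 0"
  shows "sigma j (c *\<^sub>R rank_two_perturbation y e p q r) = c ^ j * block_sym (CARD('n) - 2) j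
    ((1 + p * (y \<bullet> y)) + (1 + r)) ((1 + p * (y \<bullet> y)) * (1 + r) - q\<^sup>2 * (y \<bullet> y))"
    (is "_ = _ * block_sym _ _ ?T ?D")
proof -
  let ?K = "rank_two_perturbation y e p q r"
  let ?p = "[:1, 1:] ^ (CARD('n) - 2) * [:1, ?T, ?D:]"
  have "sigma j (c *\<^sub>R ?K) = coeff (pcompose ?p [:0, c:]) j"
  proof (rule sigma_eq_coeff)
    show "transpose (c *\<^sub>R ?K) = c *\<^sub>R ?K"
      using rank_two_perturbation_symmetric[of y e p q r] by (simp add: transpose_def vec_eq_iff)
    show "poly (pcompose ?p [:0, c:]) s = det (mat 1 + s *\<^sub>R c *\<^sub>R ?K)" for s
      using det_rank_two_perturbation[OF assms, of "s * c" p q r]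
      by (simp add: poly_pcompose) (simp add: algebra_simps power2_eq_square)
  qed
  then show ?thesis by (simp only: coeff_pcompose_linear coeff_block_sym)
qed

section \<open>Calculus of functions of class C^m\<close>

lemma partial_deriv_eq:
  "(f has_derivative f') (at x) \<Longrightarrow> partial_deriv i f x = f' (axis i 1)"
  unfolding partial_deriv_def by (metis frechet_derivative_at)

lemma partial_deriv_has_derivative:
  assumes "f differentiable (at x)"
  shows "(f has_derivative (\<lambda>v. \<Sum>i\<in>UNIV. v $ i * partial_deriv i f x)) (at x)"
proof -
  define f' where "f' = frechet_derivative f (at x)"
  have D: "(f has_derivative f') (at x)"
    using assms unfolding f'_def frechet_derivative_works .
  have lin: "linear f'" by (rule has_derivative_linear[OF D])
  have "f' v = (\<Sum>i\<in>UNIV. v $ i * partial_deriv i f x)" for v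
  proof -
    have "f' v = f' (\<Sum>i\<in>UNIV. v $ i *\<^sub>R axis i 1)"
      using basis_expansion[of v] by (simp add: scalar_mult_eq_scaleR)
    also have "\<dots> = (\<Sum>i\<in>UNIV. v $ i *\<^sub>R f' (axis i 1))"
      by (simp add: linear_sum[OF lin] linear_scale[OF lin])
    finally show ?thesis by (simp add: partial_deriv_def f'_def)
  qed
  then have "f' = (\<lambda>v. \<Sum>i\<in>UNIV. v $ i * partial_deriv i f x)" by blast
  with D show ?thesis by simp
qed

text \<open>Differentiability at a point of the open set \<open>S\<close> depends only on the values in \<open>S\<close>. This
allows the product and quotient rules, which hold only on \<open>S\<close>, to be used under the recursion
that defines \<open>Ck_on\<close>.\<close>

lemma Ck_on_cong:
  assumes "open S"
  shows "Ck_on m S f \<Longrightarrow> (\<And>x. x \<in> S \<Longrightarrow> f x = g x) \<Longrightarrow> Ck_on m S g"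
proof (induction m arbitrary: f g)
  case 0
  then show ?case using continuous_on_cong by (metis Ck_on.simps(1))
next
  case (Suc m)
  have D: "(g has_derivative frechet_derivative f (at x)) (at x)" if "x \<in> S" for x
  proof (rule has_derivative_transform_within_open)
    show "(f has_derivative frechet_derivative f (at x)) (at x)"
      using Suc.prems(1) that by (simp flip: frechet_derivative_works)
  qed (use assms that Suc.prems(2) in auto)
  have "Ck_on m S (partial_deriv i g)" for i
  proof (rule Suc.IH)
    show "Ck_on m S (partial_deriv i f)" using Suc.prems(1) by simp
    show "partial_deriv i f x = partial_deriv i g x" if "x \<in> S" for x
      using partial_deriv_eq[OF D[OF that]] by (simp add: partial_deriv_def)
  qed
  then show ?case using D by (auto simp: differentiable_def)
qed

lemma Ck_on_mono: "Ck_on (Suc m) S f \<Longrightarrow> Ck_on m S f"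
proof (induction m arbitrary: f)
  case 0
  then show ?case
    by (auto intro!: continuous_at_imp_continuous_on differentiable_imp_continuous_within)
next
  case (Suc m)
  then show ?case by (metis Ck_on.simps(2))
qed

lemma Ck_on_Suc_has_derivative:
  assumes S: "open S" and D: "\<And>x. x \<in> S \<Longrightarrow> (f has_derivative f' x) (at x)"
    and C: "\<And>i. Ck_on m S (\<lambda>x. f' x (axis i 1))"
  shows "Ck_on (Suc m) S f"
proof -
  have "Ck_on m S (partial_deriv i f)" for i
    by (rule Ck_on_cong[OF S C[of i]]) (simp add: partial_deriv_eq[OF D])
  then show ?thesis using D by (auto simp: differentiable_def)
qed

lemma Ck_on_frechet_derivative:
  "Ck_on (Suc m) S f \<Longrightarrow> Ck_on m S (\<lambda>x. frechet_derivative f (at x) (axis i 1))"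
  by (simp add: partial_deriv_def[abs_def])

lemma Ck_on_const: "open S \<Longrightarrow> Ck_on m S (\<lambda>x. c)"
proof (induction m arbitrary: c)
  case (Suc m)
  show ?case by (rule Ck_on_Suc_has_derivative[OF Suc.prems has_derivative_const Suc.IH[OF Suc.prems]])
qed simp

lemma Ck_on_coord: "open S \<Longrightarrow> Ck_on m S (\<lambda>x. x $ j)"
proof (cases m)
  case (Suc k)
  assume "open S"
  then show ?thesis unfolding Suc
    by (intro Ck_on_Suc_has_derivative[where f' = "\<lambda>x v. v $ j"] Ck_on_const
        bounded_linear_imp_has_derivative bounded_linear_vec_nth)
qed (auto intro: continuous_intros)

lemma Ck_on_add:
  assumes "open S"
  shows "Ck_on m S f \<Longrightarrow> Ck_on m S g \<Longrightarrow> Ck_on m S (\<lambda>x. f x + g x)"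
proof (induction m arbitrary: f g)
  case 0
  then show ?case by (auto intro: continuous_intros)
next
  case (Suc m)
  show ?case
  proof (rule Ck_on_Suc_has_derivative[OF assms])
    show "((\<lambda>x. f x + g x) has_derivative
        (\<lambda>v. frechet_derivative f (at x) v + frechet_derivative g (at x) v)) (at x)" if "x \<in> S" for x
      using Suc.prems that by (intro has_derivative_add) (simp_all flip: frechet_derivative_works)
    show "Ck_on m S (\<lambda>x. frechet_derivative f (at x) (axis i 1) + frechet_derivative g (at x) (axis i 1))" for i
      by (intro Suc.IH Ck_on_frechet_derivative Suc.prems)
  qed
qed

lemma Ck_on_mult:
  assumes "open S"
  shows "Ck_on m S f \<Longrightarrow> Ck_on m S g \<Longrightarrow> Ck_on m S (\<lambda>x. f x * g x)"
proof (induction m arbitrary: f g)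
  case 0
  then show ?case by (auto intro: continuous_intros)
next
  case (Suc m)
  show ?case
  proof (rule Ck_on_Suc_has_derivative[OF assms])
    show "((\<lambda>x. f x * g x) has_derivative
        (\<lambda>v. f x * frechet_derivative g (at x) v + frechet_derivative f (at x) v * g x)) (at x)" if "x \<in> S" for x
      using Suc.prems that by (intro has_derivative_mult) (simp_all flip: frechet_derivative_works)
    show "Ck_on m S (\<lambda>x. f x * frechet_derivative g (at x) (axis i 1) + frechet_derivative f (at x) (axis i 1) * g x)" for i
      by (intro Ck_on_add assms Suc.IH Ck_on_frechet_derivative Ck_on_mono[OF Suc.prems(1)]
          Ck_on_mono[OF Suc.prems(2)] Suc.prems)
  qed
qed

lemma Ck_on_inverse:
  assumes "open S" and nz: "\<And>x. x \<in> S \<Longrightarrow> f x \<noteq> 0"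
  shows "Ck_on m S f \<Longrightarrow> Ck_on m S (\<lambda>x. inverse (f x))"
proof (induction m)
  case 0
  then show ?case using nz by (auto intro: continuous_intros)
next
  case (Suc m)
  show ?case
  proof (rule Ck_on_Suc_has_derivative[OF assms(1)])
    show "((\<lambda>x. inverse (f x)) has_derivative
        (\<lambda>v. - (inverse (f x) * frechet_derivative f (at x) v * inverse (f x)))) (at x)" if "x \<in> S" for x
      using Suc.prems that nz
      by (intro Deriv.has_derivative_inverse) (simp_all flip: frechet_derivative_works)
    have inv: "Ck_on m S (\<lambda>x. inverse (f x))" using Suc.IH Ck_on_mono[OF Suc.prems] by blast
    have "Ck_on m S (\<lambda>x. (- 1) * (inverse (f x) * partial_deriv i f x * inverse (f x)))" for i
      using Suc.prems by (intro Ck_on_mult Ck_on_const assms(1) inv) simp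
    then show "Ck_on m S (\<lambda>x. - (inverse (f x) * frechet_derivative f (at x) (axis i 1) * inverse (f x)))" for i
      by (simp add: partial_deriv_def)
  qed
qed

lemma smooth_on_const: "open S \<Longrightarrow> smooth_on S (\<lambda>x. c)"
  by (simp add: smooth_on_def Ck_on_const)

lemma smooth_on_coord: "open S \<Longrightarrow> smooth_on S (\<lambda>x. x $ j)"
  by (simp add: smooth_on_def Ck_on_coord)

lemma smooth_on_add: "open S \<Longrightarrow> smooth_on S f \<Longrightarrow> smooth_on S g \<Longrightarrow> smooth_on S (\<lambda>x. f x + g x)"
  by (simp add: smooth_on_def Ck_on_add)

lemma smooth_on_mult: "open S \<Longrightarrow> smooth_on S f \<Longrightarrow> smooth_on S g \<Longrightarrow> smooth_on S (\<lambda>x. f x * g x)"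
  by (simp add: smooth_on_def Ck_on_mult)

lemma smooth_on_diff:
  assumes "open S" "smooth_on S f" "smooth_on S g"
  shows "smooth_on S (\<lambda>x. f x - g x)"
  using smooth_on_add[OF assms(1,2) smooth_on_mult[OF assms(1) smooth_on_const[OF assms(1), of "-1"] assms(3)]]
  by simp

lemma smooth_on_divide:
  assumes "open S" "smooth_on S f" "smooth_on S g" "\<And>x. x \<in> S \<Longrightarrow> g x \<noteq> 0"
  shows "smooth_on S (\<lambda>x. f x / g x)"
  using assms unfolding smooth_on_def divide_inverse by (intro allI Ck_on_mult Ck_on_inverse) auto

lemma smooth_on_power: "open S \<Longrightarrow> smooth_on S f \<Longrightarrow> smooth_on S (\<lambda>x. f x ^ p)"
  by (induction p) (simp_all add: smooth_on_const smooth_on_mult)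

lemma smooth_on_sum:
  "open S \<Longrightarrow> (\<And>i. i \<in> I \<Longrightarrow> smooth_on S (f i)) \<Longrightarrow> smooth_on S (\<lambda>x. \<Sum>i\<in>I. f i x)"
  by (induction I rule: infinite_finite_induct) (simp_all add: smooth_on_const smooth_on_add)

lemmas smooth_on_intros = smooth_on_const smooth_on_coord smooth_on_add smooth_on_mult
  smooth_on_diff smooth_on_divide smooth_on_power smooth_on_sum

section \<open>Second derivatives along lines\<close>

lemma differentiable_along_line:
  fixes \<phi> :: "real ^ 'n \<Rightarrow> real"
  assumes "\<phi> differentiable (at (x + s *\<^sub>R v))"
  shows "((\<lambda>s. \<phi> (x + s *\<^sub>R v)) has_real_derivative
    (\<Sum>i\<in>UNIV. v $ i * partial_deriv i \<phi> (x + s *\<^sub>R v))) (at s)"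
proof -
  have "((\<lambda>s. \<phi> (x + s *\<^sub>R v)) has_derivative
      (\<lambda>d. \<Sum>i\<in>UNIV. (d *\<^sub>R v) $ i * partial_deriv i \<phi> (x + s *\<^sub>R v))) (at s)"
    by (rule has_derivative_compose[where g = \<phi> and f = "\<lambda>s. x + s *\<^sub>R v" and f' = "\<lambda>d. d *\<^sub>R v"])
       (auto intro!: derivative_eq_intros partial_deriv_has_derivative[OF assms])
  moreover have "(\<lambda>d. \<Sum>i\<in>UNIV. (d *\<^sub>R v) $ i * partial_deriv i \<phi> (x + s *\<^sub>R v)) =
      (*) (\<Sum>i\<in>UNIV. v $ i * partial_deriv i \<phi> (x + s *\<^sub>R v))"
    by (auto simp: sum_distrib_left sum_distrib_right ac_simps intro!: sum.cong)
  ultimately show ?thesis by (simp add: has_field_derivative_def)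
qed

lemma hessian_along_line:
  fixes \<phi> :: "real ^ 'n \<Rightarrow> real"
  assumes C2: "Ck_on 2 S \<phi>" and x: "x \<in> S"
  shows "((\<lambda>s. \<Sum>i\<in>UNIV. v $ i * partial_deriv i \<phi> (x + s *\<^sub>R v)) has_real_derivative
    v \<bullet> (hessian \<phi> x *v v)) (at 0)"
proof -
  have D: "partial_deriv i \<phi> differentiable (at (x + 0 *\<^sub>R v))" for i
    using C2 x by (simp add: numeral_2_eq_2)
  have "((\<lambda>s. \<Sum>i\<in>UNIV. v $ i * partial_deriv i \<phi> (x + s *\<^sub>R v)) has_real_derivative
    (\<Sum>i\<in>UNIV. v $ i * (\<Sum>j\<in>UNIV. v $ j * partial_deriv j (partial_deriv i \<phi>) (x + 0 *\<^sub>R v)))) (at 0)"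
    by (intro DERIV_sum DERIV_cmult differentiable_along_line D)
  moreover have "(\<Sum>i\<in>UNIV. v $ i * (\<Sum>j\<in>UNIV. v $ j * partial_deriv j (partial_deriv i \<phi>) (x + 0 *\<^sub>R v)))
      = v \<bullet> (hessian \<phi> x *v v)"
    unfolding inner_vec_def matrix_vector_mult_def hessian_def
    by (simp add: sum_distrib_left, subst sum.swap) (simp add: ac_simps)
  ultimately show ?thesis by simp
qed

text \<open>If \<open>c > 0\<close>, then \<open>W'\<close>, which vanishes at 0, is positive just to the right of 0, so \<open>W\<close>
increases there.\<close>

lemma second_derivative_local_max:
  fixes W W' :: "real \<Rightarrow> real"
  assumes D1: "\<forall>\<^sub>F s in nhds 0. (W has_real_derivative W' s) (at s)"
    and D2: "(W' has_real_derivative c) (at 0)"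
    and max: "\<forall>\<^sub>F s in nhds 0. W s \<le> W 0"
  shows "c \<le> 0"
proof (rule ccontr)
  assume "\<not> c \<le> 0"
  obtain e where e: "e > 0" "\<And>s. \<bar>s\<bar> < e \<Longrightarrow> (W has_real_derivative W' s) (at s) \<and> W s \<le> W 0"
    using eventually_conj[OF D1 max] unfolding eventually_nhds_metric dist_real_def by auto
  have W'0: "W' 0 = 0"
    by (rule DERIV_local_max[of W "W' 0" 0 e]) (use e in auto)
  obtain d where d: "d > 0" "\<And>h. 0 < h \<Longrightarrow> h < d \<Longrightarrow> W' 0 < W' (0 + h)"
    using has_real_derivative_pos_inc_right[of W' c 0 UNIV] D2 \<open>\<not> c \<le> 0\<close> by auto
  define h where "h = min d e / 2"
  have h: "0 < h" "h < d" "h < e" using d e by (auto simp: h_def)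
  have "W 0 < W h"
  proof (rule DERIV_pos_imp_increasing_open[OF h(1)])
    show "\<exists>y. DERIV W x :> y \<and> 0 < y" if "0 < x" "x < h" for x
      using e(2)[of x] d(2)[of x] W'0 that h by (intro exI[of _ "W' x"]) auto
    show "continuous_on {0..h} W"
    proof (intro continuous_at_imp_continuous_on ballI)
      fix s assume "s \<in> {0..h}"
      then have "(W has_real_derivative W' s) (at s)" using e(2)[of s] h by auto
      then show "isCont W s" by (rule DERIV_isCont)
    qed
  qed
  then show False using e(2)[of h] h by auto
qed

text \<open>Test functions are compared with the solution only along lines. The touching function \<open>U\<close>
need only be given on the line, so it may be the restriction of the solution or a
one-dimensional comparison function.\<close>

lemma hessian_bound_of_local_max_on_line:
  fixes \<phi> :: "real ^ 'n \<Rightarrow> real" and U U' :: "real \<Rightarrow> real"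
  assumes S: "open S" and C2: "Ck_on 2 S \<phi>" and x: "x \<in> S"
    and D1: "\<forall>\<^sub>F s in nhds 0. (U has_real_derivative U' s) (at s)"
    and D2: "(U' has_real_derivative c) (at 0)"
  shows "\<forall>\<^sub>F s in nhds 0. U s - \<phi> (x + s *\<^sub>R v) \<le> U 0 - \<phi> x \<Longrightarrow> c \<le> v \<bullet> (hessian \<phi> x *v v)"
    and "\<forall>\<^sub>F s in nhds 0. U 0 - \<phi> x \<le> U s - \<phi> (x + s *\<^sub>R v) \<Longrightarrow> v \<bullet> (hessian \<phi> x *v v) \<le> c"
proof -
  define P' where "P' s = (\<Sum>i\<in>UNIV. v $ i * partial_deriv i \<phi> (x + s *\<^sub>R v))" for s
  have "((\<lambda>s. x + s *\<^sub>R v) \<longlongrightarrow> x + 0 *\<^sub>R v) (nhds 0)"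
    by (intro tendsto_intros filterlim_ident)
  then have "\<forall>\<^sub>F s in nhds 0. x + s *\<^sub>R v \<in> S"
    using topological_tendstoD S x by fastforce
  then have E1: "\<forall>\<^sub>F s in nhds 0. ((\<lambda>s. \<phi> (x + s *\<^sub>R v)) has_real_derivative P' s) (at s)"
    unfolding P'_def
    by (rule eventually_mono) (use C2 in \<open>auto simp: numeral_2_eq_2 intro!: differentiable_along_line\<close>)
  have E2: "(P' has_real_derivative v \<bullet> (hessian \<phi> x *v v)) (at 0)"
    unfolding P'_def by (rule hessian_along_line[OF C2 x])
  show "c \<le> v \<bullet> (hessian \<phi> x *v v)" if "\<forall>\<^sub>F s in nhds 0. U s - \<phi> (x + s *\<^sub>R v) \<le> U 0 - \<phi> x"
  proof -
    have "c - v \<bullet> (hessian \<phi> x *v v) \<le> 0"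
    proof (rule second_derivative_local_max)
      show "\<forall>\<^sub>F s in nhds 0. ((\<lambda>s. U s - \<phi> (x + s *\<^sub>R v)) has_real_derivative U' s - P' s) (at s)"
        using D1 E1 by eventually_elim (rule DERIV_diff)
      show "((\<lambda>s. U' s - P' s) has_real_derivative c - v \<bullet> (hessian \<phi> x *v v)) (at 0)"
        by (rule DERIV_diff[OF D2 E2])
    qed (use that in simp)
    then show ?thesis by simp
  qed
  show "v \<bullet> (hessian \<phi> x *v v) \<le> c" if "\<forall>\<^sub>F s in nhds 0. U 0 - \<phi> x \<le> U s - \<phi> (x + s *\<^sub>R v)"
  proof -
    have "v \<bullet> (hessian \<phi> x *v v) - c \<le> 0"
    proof (rule second_derivative_local_max)
      show "\<forall>\<^sub>F s in nhds 0. ((\<lambda>s. \<phi> (x + s *\<^sub>R v) - U s) has_real_derivative P' s - U' s) (at s)"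
        using D1 E1 by eventually_elim (rule DERIV_diff)
      show "((\<lambda>s. P' s - U' s) has_real_derivative v \<bullet> (hessian \<phi> x *v v) - c) (at 0)"
        by (rule DERIV_diff[OF E2 D2])
      show "\<forall>\<^sub>F s in nhds 0. \<phi> (x + s *\<^sub>R v) - U s \<le> \<phi> (x + 0 *\<^sub>R v) - U 0"
        using that by eventually_elim simp
    qed
    then show ?thesis by simp
  qed
qed

section \<open>Symmetry of the Hessian\<close>

text \<open>Two applications of the mean value theorem. The left-hand side is symmetric in \<open>i\<close> and
\<open>j\<close> while the right-hand side takes the derivatives in a definite order.\<close>

lemma mixed_difference_mean_value:
  fixes \<phi> :: "real ^ 'n \<Rightarrow> real"
  assumes C2: "Ck_on 2 S \<phi>" and h: "h > 0" and sub: "cball x (2 * h) \<subseteq> S"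
  shows "\<exists>\<xi>\<in>cball x (2 * h).
    \<phi> (x + h *\<^sub>R axis i 1 + h *\<^sub>R axis j 1) - \<phi> (x + h *\<^sub>R axis i 1) - \<phi> (x + h *\<^sub>R axis j 1) + \<phi> x
     = h\<^sup>2 * partial_deriv j (partial_deriv i \<phi>) \<xi>"
proof -
  let ?e = "\<lambda>i. axis i 1 :: real ^ 'n"
  have S: "x + a *\<^sub>R ?e i + b *\<^sub>R ?e j \<in> cball x (2 * h)" if "0 \<le> a" "a \<le> h" "0 \<le> b" "b \<le> h" for a b
  proof -
    have "norm (a *\<^sub>R ?e i + b *\<^sub>R ?e j) \<le> a + b"
      using norm_triangle_ineq[of "a *\<^sub>R ?e i" "b *\<^sub>R ?e j"] that by simp
    moreover have "dist x (x + a *\<^sub>R ?e i + b *\<^sub>R ?e j) = norm (a *\<^sub>R ?e i + b *\<^sub>R ?e j)"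
    proof -
      have "x - (x + a *\<^sub>R ?e i + b *\<^sub>R ?e j) = - (a *\<^sub>R ?e i + b *\<^sub>R ?e j)" by simp
      then show ?thesis by (simp only: dist_norm norm_minus_cancel)
    qed
    ultimately show ?thesis using that by simp
  qed
  have line: "((\<lambda>s. \<psi> (y + s *\<^sub>R ?e l)) has_real_derivative partial_deriv l \<psi> (y + s *\<^sub>R ?e l)) (at s)"
    if "\<psi> differentiable (at (y + s *\<^sub>R ?e l))" for \<psi> y l s
    using differentiable_along_line[OF that] by (simp add: axis_def if_distrib[of "\<lambda>z. z * _"] cong: if_cong)
  define g where "g a = \<phi> (x + h *\<^sub>R ?e j + a *\<^sub>R ?e i) - \<phi> (x + a *\<^sub>R ?e i)" for a
  have "\<exists>a>0. a < h \<and> g h - g 0 = (h - 0) *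
      (partial_deriv i \<phi> (x + h *\<^sub>R ?e j + a *\<^sub>R ?e i) - partial_deriv i \<phi> (x + a *\<^sub>R ?e i))"
    unfolding g_def
  proof (rule MVT2[OF h], rule DERIV_diff)
    fix a assume a: "0 \<le> a" "a \<le> h"
    have "x + h *\<^sub>R ?e j + a *\<^sub>R ?e i \<in> S" "x + a *\<^sub>R ?e i \<in> S"
      using S[of a h] S[of a 0] a h sub by (auto simp: add.assoc add.commute[of "h *\<^sub>R ?e j"])
    then show "((\<lambda>a. \<phi> (x + h *\<^sub>R ?e j + a *\<^sub>R ?e i)) has_real_derivative
         partial_deriv i \<phi> (x + h *\<^sub>R ?e j + a *\<^sub>R ?e i)) (at a)"
      "((\<lambda>a. \<phi> (x + a *\<^sub>R ?e i)) has_real_derivative partial_deriv i \<phi> (x + a *\<^sub>R ?e i)) (at a)"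
      using C2 by (auto intro!: line simp: numeral_2_eq_2)
  qed
  then obtain a where a: "0 < a" "a < h" and ga: "g h - g 0 = h *
      (partial_deriv i \<phi> (x + a *\<^sub>R ?e i + h *\<^sub>R ?e j) - partial_deriv i \<phi> (x + a *\<^sub>R ?e i + 0 *\<^sub>R ?e j))"
    by (auto simp: add.assoc add.commute[of "h *\<^sub>R ?e j"])
  have "\<exists>b>0. b < h \<and> partial_deriv i \<phi> (x + a *\<^sub>R ?e i + h *\<^sub>R ?e j) - partial_deriv i \<phi> (x + a *\<^sub>R ?e i + 0 *\<^sub>R ?e j)
     = (h - 0) * partial_deriv j (partial_deriv i \<phi>) (x + a *\<^sub>R ?e i + b *\<^sub>R ?e j)"
  proof (rule MVT2[OF h], rule line)
    fix b assume b: "0 \<le> b" "b \<le> h"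
    show "partial_deriv i \<phi> differentiable (at (x + a *\<^sub>R ?e i + b *\<^sub>R ?e j))"
      using C2 S[of a b] a b sub by (auto simp: numeral_2_eq_2)
  qed
  then obtain b where b: "0 < b" "b < h"
    and gb: "partial_deriv i \<phi> (x + a *\<^sub>R ?e i + h *\<^sub>R ?e j) - partial_deriv i \<phi> (x + a *\<^sub>R ?e i + 0 *\<^sub>R ?e j)
     = h * partial_deriv j (partial_deriv i \<phi>) (x + a *\<^sub>R ?e i + b *\<^sub>R ?e j)" by auto
  have "g h - g 0 = \<phi> (x + h *\<^sub>R ?e i + h *\<^sub>R ?e j) - \<phi> (x + h *\<^sub>R ?e i) - \<phi> (x + h *\<^sub>R ?e j) + \<phi> x"
    unfolding g_def by (simp add: add.assoc add.commute[of "h *\<^sub>R ?e j"])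
  then show ?thesis using ga gb S[of a b] a b
    by (intro bexI[of _ "x + a *\<^sub>R ?e i + b *\<^sub>R ?e j"]) (auto simp: power2_eq_square)
qed

text \<open>Otherwise the two mixed derivatives, being continuous, would take separated values on a
small ball, against \<open>mixed_difference_mean_value\<close> for both orders of differentiation. Symmetry
makes the spectral theorem applicable to the Hessians of test functions.\<close>

lemma hessian_symmetric:
  fixes \<phi> :: "real ^ 'n \<Rightarrow> real"
  assumes S: "open S" and C2: "Ck_on 2 S \<phi>" and x: "x \<in> S"
  shows "transpose (hessian \<phi> x) = hessian \<phi> x"
proof -
  have "partial_deriv i (partial_deriv j \<phi>) x = partial_deriv j (partial_deriv i \<phi>) x" for i j
  proof (rule ccontr)
    let ?p = "partial_deriv i (partial_deriv j \<phi>)" and ?q = "partial_deriv j (partial_deriv i \<phi>)"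
    assume "?p x \<noteq> ?q x"
    have cont: "continuous_on S ?p" "continuous_on S ?q" using C2 by (auto simp: numeral_2_eq_2)
    define e where "e = \<bar>?p x - ?q x\<bar> / 2"
    have e: "e > 0" using \<open>?p x \<noteq> ?q x\<close> by (simp add: e_def)
    have ev: "\<forall>\<^sub>F y in nhds x. dist (g y) (g x) < e" if "continuous_on S g" for g :: "real ^ 'n \<Rightarrow> real"
      using that S x e
      by (metis continuous_on_eq_continuous_at isCont_def tendsto_at_iff_tendsto_nhds tendstoD)
    have "\<forall>\<^sub>F y in nhds x. y \<in> S \<and> dist (?p y) (?p x) < e \<and> dist (?q y) (?q x) < e"
      using ev[OF cont(1)] ev[OF cont(2)] eventually_nhds_in_open[OF S x] by eventually_elim simp
    then obtain d where d: "d > 0"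
      "\<And>y. dist y x < d \<Longrightarrow> y \<in> S \<and> dist (?p y) (?p x) < e \<and> dist (?q y) (?q x) < e"
      unfolding eventually_nhds_metric by auto
    \<comment> \<open>The points of \<open>mixed_difference_mean_value\<close> lie within \<open>2 h < d\<close> of \<open>x\<close>.\<close>
    define h where "h = d / 4"
    have h: "h > 0" and near: "dist y x < d" if "y \<in> cball x (2 * h)" for y
      using d(1) that by (auto simp: h_def dist_commute)
    have sub: "cball x (2 * h) \<subseteq> S" using near d(2) by blast
    have "h > 0" using d(1) by (simp add: h_def)
    obtain \<xi> \<eta> where "\<xi> \<in> cball x (2 * h)" "\<eta> \<in> cball x (2 * h)" "h\<^sup>2 * ?q \<xi> = h\<^sup>2 * ?p \<eta>"
      using mixed_difference_mean_value[OF C2 \<open>h > 0\<close> sub, of i j]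
        mixed_difference_mean_value[OF C2 \<open>h > 0\<close> sub, of j i]
      by (auto simp: add.assoc add.commute algebra_simps)
    then have "?q \<xi> = ?p \<eta>" "dist (?p \<eta>) (?p x) < e" "dist (?q \<xi>) (?q x) < e"
      using \<open>h > 0\<close> d(2)[OF near, of \<xi>] d(2)[OF near, of \<eta>] by simp_all
    then show False unfolding e_def dist_real_def by argo
  qed
  then show ?thesis by (simp add: vec_eq_iff transpose_def hessian_def)
qed

section \<open>The Pogorelov-type function and its Hessian\<close>

definition drop_coord :: "'n \<Rightarrow> real ^ 'n \<Rightarrow> real ^ 'n" where
  "drop_coord t x = x - (x $ t) *\<^sub>R axis t 1"

lemma linear_drop_coord: "linear (drop_coord t)"
  by (rule linearI) (simp_all add: drop_coord_def algebra_simps)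

lemma inner_drop_coord: "drop_coord t x \<bullet> v = x \<bullet> v - x $ t * v $ t"
  by (simp add: drop_coord_def inner_diff_left inner_axis')

lemma inner_drop_drop: "drop_coord t x \<bullet> drop_coord t z = x \<bullet> z - x $ t * z $ t"
  by (simp add: drop_coord_def inner_diff_left inner_diff_right inner_axis' inner_axis inner_axis_axis)

lemma drop_coord_axis: "drop_coord t x \<bullet> axis t 1 = 0"
  by (simp add: drop_coord_def inner_axis)

lemma norm_drop_coord_le: "norm (drop_coord t x) \<le> norm x"
  by (rule norm_le[THEN iffD2]) (simp add: inner_drop_drop)

text \<open>The power \<open>1 - \<alpha>\<close> of \<open>1 - \<tau>\<^sup>2\<close> turns the function into a perspective, which makes it
convex, and for \<open>\<alpha> = 2 - 2/m\<close> it makes the right-hand side of the equation rational.\<close>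

definition pogorelov :: "real \<Rightarrow> 'n \<Rightarrow> real ^ 'n \<Rightarrow> real" where
  "pogorelov \<alpha> t x = norm (drop_coord t x) powr \<alpha> * (1 - (x $ t)\<^sup>2) powr (1 - \<alpha>)"

text \<open>The Hessian of \<open>pogorelov\<close> off the axis, as found by differentiating along lines. The
scalar in front is \<open>\<alpha> \<rho>\<^bsup>\<alpha>-2\<^esup> h\<^bsup>1-\<alpha>\<^esup>\<close>, the eigenvalue on the vectors orthogonal to \<open>y\<close> and to the
axis.\<close>

definition pogorelov_hessian :: "real \<Rightarrow> 'n \<Rightarrow> real ^ 'n \<Rightarrow> real ^ 'n ^ 'n" where
  "pogorelov_hessian \<alpha> t x = (let y = drop_coord t x; N = y \<bullet> y; \<tau> = x $ t; h = 1 - \<tau>\<^sup>2 in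
     (\<alpha> * N powr (\<alpha> / 2 - 1) * h powr (1 - \<alpha>)) *\<^sub>R
       rank_two_perturbation y (axis t 1) ((\<alpha> - 2) / N) (2 * (\<alpha> - 1) * \<tau> / h)
         ((\<alpha> - 1) * N * (4 * \<tau>\<^sup>2 + 2 * h / \<alpha>) / h\<^sup>2 - 1))"

lemma norm_powr_eq: "norm z powr a = (z \<bullet> z) powr (a / 2)"
  by (simp add: norm_eq_sqrt_inner powr_half_sqrt[symmetric] powr_powr)

lemma one_minus_sq_pos: "\<bar>\<tau>\<bar> < 1 \<Longrightarrow> 1 - \<tau>\<^sup>2 > (0 :: real)"
  by (simp add: abs_square_less_1)

lemma powr_product_derivative:
  fixes F G :: "real \<Rightarrow> real"
  assumes "(F has_real_derivative F') (at s)" "(G has_real_derivative G') (at s)" "F s > 0" "G s > 0"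
  shows "((\<lambda>s. F s powr a * G s powr b) has_real_derivative
    F s powr a * G s powr b * (a * F' / F s + b * G' / G s)) (at s)"
proof -
  have "((\<lambda>s. F s powr a * G s powr b) has_real_derivative
      F s powr a * (0 * ln (F s) + F' * a / F s) * G s powr b
      + G s powr b * (0 * ln (G s) + G' * b / G s) * F s powr a) (at s)"
    by (rule DERIV_mult[OF DERIV_powr[OF assms(1,3) DERIV_const] DERIV_powr[OF assms(2,4) DERIV_const]])
  then show ?thesis by (simp add: algebra_simps)
qed

text \<open>On the line the function is \<open>N\<^bsup>\<alpha>/2\<^esup> h\<^bsup>1-\<alpha>\<^esup>\<close> with quadratic polynomials \<open>N\<close> and \<open>h\<close>, so its
derivative is \<open>U L\<close> with the logarithmic derivative \<open>L\<close>, and the second derivative is \<open>U (L\<^sup>2 +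
L')\<close>. Quadratic forms along all lines are all that the viscosity conditions need.\<close>

lemma pogorelov_second_derivative:
  assumes y: "drop_coord t x \<noteq> 0" and x: "\<bar>x $ t\<bar> < 1" and \<alpha>: "\<alpha> \<noteq> 0"
  shows "\<exists>U'. (\<forall>\<^sub>F s in nhds 0. ((\<lambda>s. pogorelov \<alpha> t (x + s *\<^sub>R v)) has_real_derivative U' s) (at s)) \<and>
    (U' has_real_derivative v \<bullet> (pogorelov_hessian \<alpha> t x *v v)) (at 0)"
proof -
  define y where "y = drop_coord t x"
  define N0 Y V w \<tau> h0 where "N0 = y \<bullet> y" and "Y = y \<bullet> v" and "V = v \<bullet> v" and "w = v $ t"
    and "\<tau> = x $ t" and "h0 = 1 - \<tau>\<^sup>2"
  define N h where "N s = N0 + 2 * s * Y + s\<^sup>2 * (V - w\<^sup>2)" and "h s = 1 - (\<tau> + s * w)\<^sup>2" for s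
  define N' h' where "N' s = 2 * Y + 2 * s * (V - w\<^sup>2)" and "h' s = - 2 * (\<tau> + s * w) * w" for s
  define U where "U s = N s powr (\<alpha> / 2) * h s powr (1 - \<alpha>)" for s
  define L where "L s = \<alpha> / 2 * N' s / N s + (1 - \<alpha>) * h' s / h s" for s
  have N0: "N0 > 0" using y by (simp add: N0_def y_def)
  have h0: "h0 > 0" using one_minus_sq_pos[OF x] by (simp add: h0_def \<tau>_def)
  have at0: "N 0 = N0" "h 0 = h0" "N' 0 = 2 * Y" "h' 0 = - 2 * \<tau> * w"
    by (simp_all add: N_def h_def N'_def h'_def h0_def)
  have "pogorelov \<alpha> t (x + s *\<^sub>R v) = U s" for s
  proof -
    have "drop_coord t (x + s *\<^sub>R v) \<bullet> drop_coord t (x + s *\<^sub>R v) = N s"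
      unfolding inner_drop_drop N_def N0_def Y_def y_def V_def w_def
      unfolding inner_drop_coord
      by (simp add: inner_add_left inner_add_right inner_commute power2_eq_square algebra_simps)
    then show ?thesis by (simp add: pogorelov_def norm_powr_eq U_def h_def \<tau>_def w_def)
  qed
  then have U: "(\<lambda>s. pogorelov \<alpha> t (x + s *\<^sub>R v)) = U" by blast
  have dN: "(N has_real_derivative N' s) (at s)" for s
    unfolding N_def[abs_def] N'_def by (auto intro!: derivative_eq_intros)
  have dh: "(h has_real_derivative h' s) (at s)" for s
    unfolding h_def[abs_def] h'_def by (auto intro!: derivative_eq_intros simp: algebra_simps)
  have dN': "(N' has_real_derivative 2 * (V - w\<^sup>2)) (at 0)"
    unfolding N'_def[abs_def] by (auto intro!: derivative_eq_intros)
  have dh': "(h' has_real_derivative - 2 * w\<^sup>2) (at 0)"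
    unfolding h'_def[abs_def] by (auto intro!: derivative_eq_intros simp: power2_eq_square)
  have dU: "(U has_real_derivative U s * L s) (at s)" if "N s > 0" "h s > 0" for s
    unfolding U_def[abs_def] L_def using powr_product_derivative[OF dN dh that] .
  have "(N \<longlongrightarrow> N 0) (nhds 0)" "(h \<longlongrightarrow> h 0) (nhds 0)"
    using DERIV_isCont[OF dN, of 0] DERIV_isCont[OF dh, of 0]
    by (simp_all only: isCont_def tendsto_at_iff_tendsto_nhds)
  then have "\<forall>\<^sub>F s in nhds 0. N s > 0 \<and> h s > 0"
    using order_tendstoD(1)[of N "N 0" "nhds 0" 0] order_tendstoD(1)[of h "h 0" "nhds 0" 0] N0 h0
    by (simp add: eventually_conj at0)
  then have ev: "\<forall>\<^sub>F s in nhds 0. (U has_real_derivative U s * L s) (at s)"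
    by eventually_elim (simp add: dU)
  have dL: "(L has_real_derivative \<alpha> / 2 * ((2 * (V - w\<^sup>2)) * N0 - (2 * Y) * (2 * Y)) / (N0 * N0)
      + (1 - \<alpha>) * ((- 2 * w\<^sup>2) * h0 - (- 2 * \<tau> * w) * (- 2 * \<tau> * w)) / (h0 * h0)) (at 0)"
    unfolding L_def[abs_def]
    by (rule DERIV_cong[OF DERIV_add[OF DERIV_divide[OF DERIV_cmult[OF dN'] dN]
            DERIV_divide[OF DERIV_cmult[OF dh'] dh]]])
       (use N0 h0 in \<open>simp_all add: at0 algebra_simps\<close>)
  define c where "c = \<alpha> * U 0 / N0 * (V + (\<alpha> - 2) / N0 * Y\<^sup>2 + 2 * (2 * (\<alpha> - 1) * \<tau> / h0) * Y * w
      + ((\<alpha> - 1) * N0 * (4 * \<tau>\<^sup>2 + 2 * h0 / \<alpha>) / h0\<^sup>2 - 1) * w\<^sup>2)"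
  have "((\<lambda>s. U s * L s) has_real_derivative c) (at 0)"
    by (rule DERIV_cong[OF DERIV_mult[OF dU dL]])
       (use N0 h0 \<alpha> in \<open>simp_all add: at0 c_def L_def divide_simps\<close>,
        simp_all add: power2_eq_square algebra_simps)
  moreover have "v \<bullet> (pogorelov_hessian \<alpha> t x *v v) = c"
  proof -
    have "\<alpha> * N0 powr (\<alpha> / 2 - 1) * h0 powr (1 - \<alpha>) = \<alpha> * U 0 / N0"
      using N0 by (simp add: U_def at0 powr_diff[of N0] ac_simps)
    then show ?thesis
      unfolding pogorelov_hessian_def Let_def
      by (simp add: scaleR_matrix_vector_assoc[symmetric] rank_two_perturbation_quadratic_form
          y_def[symmetric] N0_def[symmetric] Y_def[symmetric] V_def[symmetric] w_def[symmetric]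
          \<tau>_def[symmetric] h0_def[symmetric] c_def inner_axis')
  qed
  ultimately show ?thesis unfolding U using ev by (intro exI[of _ "\<lambda>s. U s * L s"]) simp
qed

section \<open>The right-hand side\<close>

text \<open>Trace and determinant of the normalized Hessian on the plane spanned by \<open>drop_coord t x\<close>
and the axis, where \<open>x \<bullet> x - (x $ t)\<^sup>2\<close> is the squared distance from the axis. Written in this
way they make sense on the axis as well.\<close>

definition pogorelov_trace :: "real \<Rightarrow> 'n \<Rightarrow> real ^ 'n \<Rightarrow> real" where
  "pogorelov_trace \<alpha> t x = (\<alpha> - 1) + (\<alpha> - 1) * (x \<bullet> x - (x $ t)\<^sup>2)
     * (4 * (x $ t)\<^sup>2 + 2 * (1 - (x $ t)\<^sup>2) / \<alpha>) / (1 - (x $ t)\<^sup>2)\<^sup>2"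

definition pogorelov_det :: "real \<Rightarrow> 'n \<Rightarrow> real ^ 'n \<Rightarrow> real" where
  "pogorelov_det \<alpha> t x = (\<alpha> - 1)\<^sup>2 * (2 / \<alpha>) * (x \<bullet> x - (x $ t)\<^sup>2) / (1 - (x $ t)\<^sup>2)"

definition pogorelov_rhs :: "nat \<Rightarrow> real \<Rightarrow> 'n \<Rightarrow> real ^ 'n \<Rightarrow> real" where
  "pogorelov_rhs k \<alpha> t x = \<alpha> ^ (CARD('n) - k) * (\<alpha> - 1)\<^sup>2 * (2 / \<alpha>) /
     ((1 - (x $ t)\<^sup>2) ^ (CARD('n) - k - 1) *
       block_sym (CARD('n) - 2) k (pogorelov_trace \<alpha> t x) (pogorelov_det \<alpha> t x))"

lemma coord_less_1: "x \<in> ball 0 1 \<Longrightarrow> \<bar>x $ t\<bar> < 1" for x :: "real ^ 'n"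
  using component_le_norm_cart[of x t] by simp

lemma block_sym_pogorelov_pos:
  fixes x :: "real ^ 'n"
  assumes "1 < \<alpha>" "x \<in> ball 0 1" "k \<le> m"
  shows "block_sym m k (pogorelov_trace \<alpha> t x) (pogorelov_det \<alpha> t x) > 0"
proof -
  have N: "x \<bullet> x - (x $ t)\<^sup>2 \<ge> 0"
    using inner_ge_zero[of "drop_coord t x"] by (simp add: inner_drop_drop power2_eq_square)
  have h: "1 - (x $ t)\<^sup>2 > 0" by (rule one_minus_sq_pos[OF coord_less_1[OF assms(2)]])
  have "pogorelov_trace \<alpha> t x \<ge> 0" unfolding pogorelov_trace_def
    using assms(1) N h by (intro add_nonneg_nonneg divide_nonneg_nonneg mult_nonneg_nonneg) auto
  moreover have "pogorelov_det \<alpha> t x \<ge> 0" unfolding pogorelov_det_def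
    using assms(1) N h by (intro divide_nonneg_nonneg mult_nonneg_nonneg) auto
  moreover have "m choose k > 0" using assms(3) by (simp add: zero_less_binomial)
  ultimately show ?thesis unfolding block_sym_def
    by (intro add_pos_nonneg) auto
qed

lemma pogorelov_rhs_pos:
  fixes x :: "real ^ 'n"
  assumes "1 < \<alpha>" "x \<in> ball 0 1" "k \<le> CARD('n) - 2"
  shows "pogorelov_rhs k \<alpha> t x > 0"
  unfolding pogorelov_rhs_def
  using assms block_sym_pogorelov_pos[OF assms] one_minus_sq_pos[OF coord_less_1[OF assms(2)]]
  by (intro divide_pos_pos mult_pos_pos zero_less_power) auto

lemma pogorelov_rhs_smooth:
  fixes t :: "'n::finite"
  assumes \<alpha>: "1 < \<alpha>" and k: "k \<le> CARD('n) - 2" and S: "open S" "S \<subseteq> ball 0 1"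
  shows "smooth_on S (pogorelov_rhs k \<alpha> t)"
proof -
  have N: "smooth_on S (\<lambda>x. x \<bullet> x - (x $ t)\<^sup>2)"
    unfolding inner_vec_def inner_real_def by (intro smooth_on_intros S(1))
  have h: "1 - (x $ t)\<^sup>2 \<noteq> 0" if "x \<in> S" for x :: "real ^ 'n"
    using one_minus_sq_pos[OF coord_less_1[OF subsetD[OF S(2) that]], of t] by simp
  have T: "smooth_on S (pogorelov_trace \<alpha> t)"
    unfolding pogorelov_trace_def using \<alpha> h by (intro smooth_on_intros N S(1)) auto
  have D: "smooth_on S (pogorelov_det \<alpha> t)"
    unfolding pogorelov_det_def using \<alpha> h by (intro smooth_on_intros N S(1)) auto
  have "smooth_on S (\<lambda>x. block_sym (CARD('n) - 2) k (pogorelov_trace \<alpha> t x) (pogorelov_det \<alpha> t x))"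
    unfolding block_sym_def
    by (cases "k \<ge> 1"; cases "k \<ge> 2") (auto intro!: smooth_on_intros T D S(1))
  then show ?thesis unfolding pogorelov_rhs_def
    using \<alpha> h block_sym_pogorelov_pos[OF \<alpha> subsetD[OF S(2)] k, of _ t]
    by (intro smooth_on_intros S(1)) (auto simp: less_imp_neq[symmetric])
qed

text \<open>All quantities come from \<open>rank_two_perturbation\<close> with \<open>1 + p N = \<alpha> - 1\<close>, where \<open>N\<close> is the
squared distance from the axis. Positivity rests on the identity \<open>(\<alpha> - 1) (1 + r) - q\<^sup>2 N = (\<alpha> -
1)\<^sup>2 (2 / \<alpha>) N / h\<close>, whose right-hand side is positive because \<open>1 - \<tau>\<^sup>2\<close> is strictly concave.\<close>

lemma pogorelov_hessian_properties:
  fixes x :: "real ^ 'n"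
  assumes y: "drop_coord t x \<noteq> 0" and x: "x \<in> ball 0 1" and \<alpha>: "1 < \<alpha>" and n: "CARD('n) \<ge> 2"
  obtains c where "c > 0" "c = \<alpha> * (x \<bullet> x - (x $ t)\<^sup>2) powr (\<alpha> / 2 - 1) * (1 - (x $ t)\<^sup>2) powr (1 - \<alpha>)"
    "\<And>j. sigma j (pogorelov_hessian \<alpha> t x) = c ^ j *
       block_sym (CARD('n) - 2) j (pogorelov_trace \<alpha> t x) (pogorelov_det \<alpha> t x)"
    "positive_definite (pogorelov_hessian \<alpha> t x)"
    "transpose (pogorelov_hessian \<alpha> t x) = pogorelov_hessian \<alpha> t x"
proof -
  define y where "y = drop_coord t x"
  define N \<tau> h where "N = y \<bullet> y" and "\<tau> = x $ t" and "h = 1 - \<tau>\<^sup>2"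
  define c p q r where "c = \<alpha> * N powr (\<alpha> / 2 - 1) * h powr (1 - \<alpha>)" and "p = (\<alpha> - 2) / N"
    and "q = 2 * (\<alpha> - 1) * \<tau> / h" and "r = (\<alpha> - 1) * N * (4 * \<tau>\<^sup>2 + 2 * h / \<alpha>) / h\<^sup>2 - 1"
  let ?K = "rank_two_perturbation y (axis t 1) p q r"
  have H: "pogorelov_hessian \<alpha> t x = c *\<^sub>R ?K"
    by (simp add: pogorelov_hessian_def Let_def c_def p_def q_def r_def y_def N_def \<tau>_def h_def)
  have y0: "y \<noteq> 0" and e: "norm (axis t 1 :: real ^ 'n) = 1" and ye: "y \<bullet> axis t 1 = 0"
    using y by (simp_all add: y_def drop_coord_axis)
  have N: "N > 0" using y0 by (simp add: N_def)
  have Nx: "N = x \<bullet> x - (x $ t)\<^sup>2" by (simp add: N_def y_def inner_drop_drop power2_eq_square)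
  have h: "h > 0" unfolding h_def \<tau>_def by (rule one_minus_sq_pos[OF coord_less_1[OF x]])
  have c: "c > 0" using \<alpha> N h by (simp add: c_def)
  have P: "1 + p * (y \<bullet> y) = \<alpha> - 1" using N by (simp add: p_def N_def[symmetric])
  have T: "(1 + p * (y \<bullet> y)) + (1 + r) = pogorelov_trace \<alpha> t x"
    unfolding P by (simp add: r_def pogorelov_trace_def Nx h_def \<tau>_def)
  have D: "(1 + p * (y \<bullet> y)) * (1 + r) - q\<^sup>2 * (y \<bullet> y) = pogorelov_det \<alpha> t x"
  proof -
    have "(\<alpha> - 1) * (1 + r) - q\<^sup>2 * N = (\<alpha> - 1)\<^sup>2 * (2 / \<alpha>) * N / h"
      using h \<alpha> unfolding r_def q_def by (simp add: divide_simps) (simp add: power2_eq_square algebra_simps)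
    then show ?thesis unfolding P by (simp add: pogorelov_det_def Nx h_def \<tau>_def flip: N_def)
  qed
  have Dpos: "pogorelov_det \<alpha> t x > 0"
    using N h \<alpha> by (simp add: pogorelov_det_def Nx h_def \<tau>_def)
  have K: "positive_definite ?K"
    by (rule positive_definite_rank_two_perturbation[OF y0 e ye]) (use P D Dpos \<alpha> in linarith)+
  show ?thesis
  proof (rule that[OF c])
    show "c = \<alpha> * (x \<bullet> x - (x $ t)\<^sup>2) powr (\<alpha> / 2 - 1) * (1 - (x $ t)\<^sup>2) powr (1 - \<alpha>)"
      by (simp add: c_def Nx h_def \<tau>_def)
    show "sigma j (pogorelov_hessian \<alpha> t x) = c ^ j *
       block_sym (CARD('n) - 2) j (pogorelov_trace \<alpha> t x) (pogorelov_det \<alpha> t x)" for j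
      unfolding H sigma_scaled_rank_two_perturbation[OF y0 e ye] T D ..
    show "positive_definite (pogorelov_hessian \<alpha> t x)"
      using K c unfolding H positive_definite_def by (simp add: scaleR_matrix_vector_assoc[symmetric])
    show "transpose (pogorelov_hessian \<alpha> t x) = pogorelov_hessian \<alpha> t x"
      using rank_two_perturbation_symmetric[of y "axis t 1" p q r] unfolding H
      by (simp add: transpose_def vec_eq_iff)
  qed
qed

text \<open>Here the exponent is used. Since \<open>m (\<alpha>/2 - 1) = -1\<close>, the factor \<open>c\<^sup>m\<close>, with \<open>c\<close> the scalar
in front of the Hessian, contributes \<open>1/N\<close> and cancels the only factor that vanishes on the
axis, the \<open>N\<close> in the determinant. Since \<open>m (1 - \<alpha>) = 2 - m\<close>, only integral powers of \<open>h\<close>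
remain.\<close>

lemma pogorelov_sigma_quotient:
  fixes x :: "real ^ 'n"
  assumes y: "drop_coord t x \<noteq> 0" and x: "x \<in> ball 0 1" and k: "k + 3 \<le> CARD('n)"
    and \<alpha>: "\<alpha> = 2 - 2 / real (CARD('n) - k)"
  shows "sigma CARD('n) (pogorelov_hessian \<alpha> t x) / sigma k (pogorelov_hessian \<alpha> t x) = pogorelov_rhs k \<alpha> t x"
proof -
  define m where "m = CARD('n) - k"
  have m: "m \<ge> 3" and n: "CARD('n) = m + k" using k by (auto simp: m_def)
  have \<alpha>1: "1 < \<alpha>" using m unfolding \<alpha> m_def[symmetric] by (simp add: field_simps)
  have am: "\<alpha> * real m = 2 * real m - 2" using m unfolding \<alpha> m_def[symmetric] by (simp add: field_simps)
  define N h T D where "N = x \<bullet> x - (x $ t)\<^sup>2" and "h = 1 - (x $ t)\<^sup>2"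
    and "T = pogorelov_trace \<alpha> t x" and "D = pogorelov_det \<alpha> t x"
  have N: "N > 0" using y inner_gt_zero_iff[of "drop_coord t x"]
    unfolding N_def by (simp add: inner_drop_drop power2_eq_square)
  have h: "h > 0" unfolding h_def by (rule one_minus_sq_pos[OF coord_less_1[OF x]])
  obtain c where c: "c > 0" "c = \<alpha> * N powr (\<alpha> / 2 - 1) * h powr (1 - \<alpha>)"
    and sig: "\<And>j. sigma j (pogorelov_hessian \<alpha> t x) = c ^ j * block_sym (CARD('n) - 2) j T D"
  proof -
    have "CARD('n) \<ge> 2" using k by simp
    from pogorelov_hessian_properties[OF y x \<alpha>1 this] that show ?thesis
      unfolding N_def h_def T_def D_def by blast
  qed
  \<comment> \<open>The top function \<open>\<sigma>\<^sub>n\<close> is the determinant.\<close>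
  have top: "block_sym (CARD('n) - 2) CARD('n) T D = D"
    using k by (simp add: block_sym_def binomial_eq_0)
  have "c ^ m * N = \<alpha> ^ m / h ^ (m - 2)"
  proof -
    have "(N powr (\<alpha> / 2 - 1)) ^ m = N powr (- 1)"
    proof -
      have "real m * (\<alpha> / 2 - 1) = - 1" using am by (simp add: algebra_simps)
      then show ?thesis using N powr_power[of N "\<alpha> / 2 - 1" m] by simp
    qed
    moreover have "(h powr (1 - \<alpha>)) ^ m = h powr (- real (m - 2))"
    proof -
      have "real m * (1 - \<alpha>) = - real (m - 2)" using am m by (simp add: algebra_simps of_nat_diff)
      then show ?thesis using h powr_power[of h "1 - \<alpha>" m] by simp
    qed
    ultimately have "c ^ m * N = \<alpha> ^ m * N powr (- 1) * h powr (- real (m - 2)) * N"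
      unfolding c(2) power_mult_distrib by simp
    then show ?thesis using N h by (simp add: powr_minus powr_realpow divide_inverse)
  qed
  note cmN = this
  have "c ^ m * D = \<alpha> ^ m * (\<alpha> - 1)\<^sup>2 * (2 / \<alpha>) / h ^ (m - 1)"
  proof -
    have "c ^ m * D = (c ^ m * N) * ((\<alpha> - 1)\<^sup>2 * (2 / \<alpha>)) / h"
      by (simp add: D_def pogorelov_det_def N_def h_def)
    also have "\<dots> = \<alpha> ^ m * (\<alpha> - 1)\<^sup>2 * (2 / \<alpha>) / (h ^ (m - 2) * h)"
      unfolding cmN by (simp add: ac_simps)
    also have "h ^ (m - 2) * h = h ^ (m - 1)"
    proof -
      have "m - 1 = Suc (m - 2)" using m by simp
      then show ?thesis by simp
    qed
    finally show ?thesis .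
  qed
  moreover have "sigma CARD('n) (pogorelov_hessian \<alpha> t x) / sigma k (pogorelov_hessian \<alpha> t x)
      = c ^ m * D / block_sym (CARD('n) - 2) k T D"
    unfolding sig top using c(1) by (simp add: n power_add)
  ultimately show ?thesis
    by (simp add: pogorelov_rhs_def m_def h_def T_def D_def)
qed

section \<open>The viscosity property\<close>

lemma eventually_along_line:
  fixes x v :: "'a :: real_normed_vector"
  assumes "eventually P (nhds x)"
  shows "\<forall>\<^sub>F s in nhds 0. P (x + s *\<^sub>R v)"
proof (rule eventually_compose_filterlim[OF assms])
  have "((\<lambda>s. x + s *\<^sub>R v) \<longlongrightarrow> x + 0 *\<^sub>R v) (nhds 0)"
    by (intro tendsto_intros filterlim_ident)
  then show "filterlim (\<lambda>s. x + s *\<^sub>R v) (nhds x) (nhds 0)" by simp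
qed

lemma pogorelov_on_axis:
  "drop_coord t x = 0 \<Longrightarrow> pogorelov \<alpha> t x = 0"
  "drop_coord t x = 0 \<Longrightarrow> pogorelov \<alpha> t (x + s *\<^sub>R axis t 1) = 0"
  "drop_coord t x = 0 \<Longrightarrow> a \<noteq> t \<Longrightarrow>
     pogorelov \<alpha> t (x + s *\<^sub>R axis a 1) = \<bar>s\<bar> powr \<alpha> * (1 - (x $ t)\<^sup>2) powr (1 - \<alpha>)"
proof -
  assume x: "drop_coord t x = 0"
  show "pogorelov \<alpha> t x = 0" by (simp add: pogorelov_def x)
  have e: "drop_coord t (x + s *\<^sub>R axis t 1) = 0"
    using x by (simp add: drop_coord_def algebra_simps)
  show "pogorelov \<alpha> t (x + s *\<^sub>R axis t 1) = 0" unfolding pogorelov_def e by simp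
  assume "a \<noteq> t"
  then have n: "axis a (1::real) $ t = 0" by (simp add: axis_def)
  then have "drop_coord t (x + s *\<^sub>R axis a 1) = s *\<^sub>R axis a 1"
    using x by (simp add: drop_coord_def algebra_simps)
  then show "pogorelov \<alpha> t (x + s *\<^sub>R axis a 1) = \<bar>s\<bar> powr \<alpha> * (1 - (x $ t)\<^sup>2) powr (1 - \<alpha>)"
    using n by (simp add: pogorelov_def)
qed

lemma exists_other_index:
  fixes t :: "'n::finite"
  assumes "CARD('n) \<ge> 2"
  shows "\<exists>a. a \<noteq> t"
proof (rule ccontr)
  assume "\<not> ?thesis"
  then have "UNIV = {t}" by auto
  then have "CARD('n) = card {t}" by (rule arg_cong)
  then show False using assms by simp
qed

lemma quadratic_le_powr_near_0:
  fixes \<alpha> c M :: real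
  assumes "\<alpha> < 2" "c > 0"
  shows "\<forall>\<^sub>F s in nhds 0. M * s\<^sup>2 \<le> \<bar>s\<bar> powr \<alpha> * c"
proof -
  have "((\<lambda>s. M * \<bar>s\<bar> powr (2 - \<alpha>)) \<longlongrightarrow> M * \<bar>0\<bar> powr (2 - \<alpha>)) (nhds 0)"
    by (intro tendsto_intros filterlim_ident) (use assms in auto)
  then have "\<forall>\<^sub>F s in nhds 0. M * \<bar>s\<bar> powr (2 - \<alpha>) < c"
    using assms(2) by (intro order_tendstoD(2)) auto
  then show ?thesis
  proof eventually_elim
    case (elim s)
    have "\<bar>s\<bar> powr (2 - \<alpha>) * \<bar>s\<bar> powr \<alpha> = s\<^sup>2"
      by (cases "s = 0") (simp_all flip: powr_add add: powr_numeral)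
    then have "M * s\<^sup>2 = (M * \<bar>s\<bar> powr (2 - \<alpha>)) * \<bar>s\<bar> powr \<alpha>" by (simp only: mult.assoc)
    also have "\<dots> \<le> c * \<bar>s\<bar> powr \<alpha>" using elim by (intro mult_right_mono) auto
    finally show ?case by (simp add: mult.commute)
  qed
qed

text \<open>Orthogonally to the axis the solution is \<open>|s|\<^sup>\<alpha>\<close> times a positive constant, which near 0
lies above every parabola \<open>M s\<^sup>2\<close>. So the parabolas all touch \<open>\<phi>\<close> as well, and its second
derivative would exceed every bound.\<close>

lemma no_touching_from_above_on_axis:
  fixes x :: "real ^ 'n"
  assumes S: "open S" and C2: "Ck_on 2 S \<phi>" and x: "x \<in> S" "x \<in> ball 0 1" and n: "CARD('n) \<ge> 2"
    and ax: "drop_coord t x = 0" and \<alpha>: "\<alpha> < 2"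
  shows "\<not> local_max_at (\<lambda>x. pogorelov \<alpha> t x - \<phi> x) x"
proof
  assume max: "local_max_at (\<lambda>x. pogorelov \<alpha> t x - \<phi> x) x"
  obtain a where a: "a \<noteq> t"
    using exists_other_index[OF n] by blast
  let ?v = "axis a 1 :: real ^ 'n"
  define c where "c = (1 - (x $ t)\<^sup>2) powr (1 - \<alpha>)"
  have c: "c > 0" using one_minus_sq_pos[OF coord_less_1[OF x(2)], of t] by (simp add: c_def)
  \<comment> \<open>Any \<open>M\<close> with \<open>2 M\<close> above the second derivative of \<open>\<phi>\<close> in the direction \<open>?v\<close> gives a contradiction.\<close>
  define M where "M = ?v \<bullet> (hessian \<phi> x *v ?v) / 2 + 1"
  have "2 * M \<le> ?v \<bullet> (hessian \<phi> x *v ?v)"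
  proof (rule hessian_bound_of_local_max_on_line(1)[OF S C2 x(1)])
    show "\<forall>\<^sub>F s in nhds 0. ((\<lambda>s. M * s\<^sup>2) has_real_derivative 2 * M * s) (at s)"
      by (intro always_eventually allI) (auto intro!: derivative_eq_intros)
    show "((\<lambda>s. 2 * M * s) has_real_derivative 2 * M) (at 0)"
      by (auto intro!: derivative_eq_intros)
    show "\<forall>\<^sub>F s in nhds 0. M * s\<^sup>2 - \<phi> (x + s *\<^sub>R ?v) \<le> M * 0\<^sup>2 - \<phi> x"
      using eventually_along_line[OF max[unfolded local_max_at_def], of ?v]
        quadratic_le_powr_near_0[OF \<alpha> c, of M]
      by eventually_elim
        (simp add: pogorelov_on_axis(3)[OF ax a] pogorelov_on_axis(1)[OF ax] c_def)
  qed
  then show False by (simp add: M_def)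
qed

text \<open>Along the axis the solution vanishes, so \<open>\<phi>\<close> has a local maximum there.\<close>

lemma no_touching_from_below_on_axis:
  fixes x :: "real ^ 'n"
  assumes S: "open S" and C2: "Ck_on 2 S \<phi>" and x: "x \<in> S"
    and ax: "drop_coord t x = 0" and min: "local_min_at (\<lambda>x. pogorelov \<alpha> t x - \<phi> x) x"
  shows "\<not> positive_definite (hessian \<phi> x)"
proof -
  let ?v = "axis t 1 :: real ^ 'n"
  have "?v \<bullet> (hessian \<phi> x *v ?v) \<le> 0"
  proof (rule hessian_bound_of_local_max_on_line(2)[OF S C2 x, of "\<lambda>s. 0" "\<lambda>s. 0"])
    show "\<forall>\<^sub>F s in nhds 0. 0 - \<phi> x \<le> 0 - \<phi> (x + s *\<^sub>R ?v)"
      using eventually_along_line[OF min[unfolded local_min_at_def], of ?v]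
      by (simp add: pogorelov_on_axis(1,2)[OF ax])
  qed auto
  then show ?thesis unfolding positive_definite_def by (metis axis_eq_0_iff not_less zero_neq_one)
qed

lemma pogorelov_viscosity_solution:
  fixes t :: "'n::finite"
  assumes S: "open S" "S \<subseteq> ball 0 1" and k: "k + 3 \<le> CARD('n)"
    and \<alpha>: "\<alpha> = 2 - 2 / real (CARD('n) - k)"
  shows "viscosity_solution k (pogorelov_rhs k \<alpha> t) S (pogorelov \<alpha> t)"
  unfolding viscosity_solution_def
proof (intro allI impI ballI conjI)
  have m: "real (CARD('n) - k) \<ge> 3" using k by simp
  have \<alpha>1: "1 < \<alpha>" and \<alpha>2: "\<alpha> < 2" using m unfolding \<alpha> by (simp_all add: field_simps)
  have n2: "CARD('n) \<ge> 2" using k by simp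
  fix \<phi> :: "real ^ 'n \<Rightarrow> real" and x
  assume C2: "Ck_on 2 S \<phi>" and x: "x \<in> S"
  have x1: "x \<in> ball 0 1" using x S by blast
  let ?H = "pogorelov_hessian \<alpha> t x" and ?P = "hessian \<phi> x"
  have symP: "transpose ?P = ?P" by (rule hessian_symmetric[OF S(1) C2 x])
  show "positive_definite ?P" "sigma CARD('n) ?P / sigma k ?P \<ge> pogorelov_rhs k \<alpha> t x"
    if max: "local_max_at (\<lambda>x. pogorelov \<alpha> t x - \<phi> x) x"
  proof -
    have y: "drop_coord t x \<noteq> 0"
      using no_touching_from_above_on_axis[OF S(1) C2 x x1 n2 _ \<alpha>2] max by blast
    have H: "positive_definite ?H" "transpose ?H = ?H"
      using pogorelov_hessian_properties[OF y x1 \<alpha>1 n2] by blast+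
    have le: "v \<bullet> (?H *v v) \<le> v \<bullet> (?P *v v)" for v
    proof -
      obtain U' where U': "\<forall>\<^sub>F s in nhds 0. ((\<lambda>s. pogorelov \<alpha> t (x + s *\<^sub>R v)) has_real_derivative U' s) (at s)"
        "(U' has_real_derivative v \<bullet> (?H *v v)) (at 0)"
        using pogorelov_second_derivative[OF y coord_less_1[OF x1], of \<alpha> v] \<alpha>1 by auto
      show ?thesis
        by (rule hessian_bound_of_local_max_on_line(1)[OF S(1) C2 x U'])
          (use eventually_along_line[OF max[unfolded local_max_at_def], of v] in simp)
    qed
    show "positive_definite ?P"
      using H(1) le unfolding positive_definite_def by (meson less_le_trans)
    have "sigma CARD('n) ?H / sigma k ?H \<le> sigma CARD('n) ?P / sigma k ?P"
      by (rule sigma_quotient_mono[OF H(2) symP H(1) le]) (use k in simp)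
    then show "sigma CARD('n) ?P / sigma k ?P \<ge> pogorelov_rhs k \<alpha> t x"
      by (simp add: pogorelov_sigma_quotient[OF y x1 k \<alpha>])
  qed
  show "sigma CARD('n) ?P / sigma k ?P \<le> pogorelov_rhs k \<alpha> t x"
    if "local_min_at (\<lambda>x. pogorelov \<alpha> t x - \<phi> x) x \<and> positive_definite ?P"
  proof -
    have min: "local_min_at (\<lambda>x. pogorelov \<alpha> t x - \<phi> x) x" and P: "positive_definite ?P"
      using that by auto
    have y: "drop_coord t x \<noteq> 0"
      using no_touching_from_below_on_axis[OF S(1) C2 x _ min] P by blast
    have H: "transpose ?H = ?H"
      using pogorelov_hessian_properties[OF y x1 \<alpha>1 n2] by blast
    have le: "v \<bullet> (?P *v v) \<le> v \<bullet> (?H *v v)" for v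
    proof -
      obtain U' where U': "\<forall>\<^sub>F s in nhds 0. ((\<lambda>s. pogorelov \<alpha> t (x + s *\<^sub>R v)) has_real_derivative U' s) (at s)"
        "(U' has_real_derivative v \<bullet> (?H *v v)) (at 0)"
        using pogorelov_second_derivative[OF y coord_less_1[OF x1], of \<alpha> v] \<alpha>1 by auto
      show ?thesis
        by (rule hessian_bound_of_local_max_on_line(2)[OF S(1) C2 x U'])
          (use eventually_along_line[OF min[unfolded local_min_at_def], of v] in simp)
    qed
    have "sigma CARD('n) ?P / sigma k ?P \<le> sigma CARD('n) ?H / sigma k ?H"
      by (rule sigma_quotient_mono[OF symP H P le]) (use k in simp)
    then show ?thesis by (simp add: pogorelov_sigma_quotient[OF y x1 k \<alpha>])
  qed
qed

section \<open>Convexity\<close>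

text \<open>Extends \<open>powr_convex\<close> to the boundary point 0, since the base \<open>\<rho>\<close> vanishes on the axis.\<close>

lemma powr_convex_nonneg:
  fixes a b :: real
  assumes "1 \<le> p" "0 \<le> a" "0 \<le> b" "0 \<le> u" "0 \<le> v" "u + v = 1"
  shows "(u * a + v * b) powr p \<le> u * a powr p + v * b powr p"
proof (cases "a = 0 \<or> b = 0 \<or> u = 0 \<or> v = 0")
  case False
  then show ?thesis
    using convex_onD[OF powr_convex[OF assms(1)], of v a b] assms by (simp add: eq_diff_eq[symmetric])
next
  case True
  have *: "(w * z) powr p \<le> w * z powr p" if "0 \<le> w" "w \<le> 1" "0 \<le> z" for w z :: real
  proof -
    have "w powr p \<le> w powr 1" using that assms(1) by (intro powr_mono') auto
    then have "w powr p \<le> w" using that by simp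
    then show ?thesis using that by (simp add: powr_mult mult_right_mono)
  qed
  have "u \<le> 1" "v \<le> 1" using assms by auto
  then show ?thesis using True *[of u a] *[of v b] assms by auto
qed

text \<open>Joint convexity of \<open>(z, y) \<mapsto> y (z / y)\<^sup>\<alpha>\<close>: the quotient of the two sums is the average of
\<open>a / g\<close> and \<open>b / h\<close> with weights proportional to \<open>u g\<close> and \<open>v h\<close>.\<close>

lemma perspective_powr_convex:
  fixes a b g h :: real
  assumes \<alpha>: "1 \<le> \<alpha>" and "0 \<le> a" "0 \<le> b" "0 < g" "0 < h" "0 \<le> u" "0 \<le> v" "u + v = 1"
  shows "(u * a + v * b) powr \<alpha> * (u * g + v * h) powr (1 - \<alpha>)
    \<le> u * (a powr \<alpha> * g powr (1 - \<alpha>)) + v * (b powr \<alpha> * h powr (1 - \<alpha>))"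
proof -
  define s where "s = u * g + v * h"
  have s: "s > 0" using assms unfolding s_def
    by (cases "u = 0") (auto intro: add_pos_nonneg)
  have persp: "z powr \<alpha> * y powr (1 - \<alpha>) = y * (z / y) powr \<alpha>" if "0 \<le> z" "0 < y" for z y
    using that by (simp add: powr_divide powr_diff)
  have "(u * a + v * b) powr \<alpha> * s powr (1 - \<alpha>)
      = s * ((u * g / s) * (a / g) + (v * h / s) * (b / h)) powr \<alpha>"
    using assms s by (subst persp) (auto simp: add_divide_distrib)
  also have "\<dots> \<le> s * ((u * g / s) * (a / g) powr \<alpha> + (v * h / s) * (b / h) powr \<alpha>)"
    using assms s by (intro mult_left_mono powr_convex_nonneg)
      (auto simp: s_def add_divide_distrib[symmetric])
  also have "\<dots> = u * (a powr \<alpha> * g powr (1 - \<alpha>)) + v * (b powr \<alpha> * h powr (1 - \<alpha>))"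
    using assms s by (simp add: persp distrib_left)
  finally show ?thesis by (simp add: s_def)
qed

lemma pogorelov_convex:
  fixes S :: "(real ^ 'n) set"
  assumes \<alpha>: "1 \<le> \<alpha>" and S: "convex S" "S \<subseteq> ball 0 1"
  shows "convex_on S (pogorelov \<alpha> t)"
proof (rule convex_onI)
  fix \<theta> :: real and x z :: "real ^ 'n"
  assume \<theta>: "0 < \<theta>" "\<theta> < 1" and x: "x \<in> S" and z: "z \<in> S"
  let ?w = "(1 - \<theta>) *\<^sub>R x + \<theta> *\<^sub>R z"
  let ?h = "\<lambda>x. 1 - (x $ t)\<^sup>2"
  have hx: "?h x > 0" and hz: "?h z > 0"
    using one_minus_sq_pos[OF coord_less_1, of _ t] S(2) x z by blast+
  \<comment> \<open>\<open>1 - \<tau>\<^sup>2\<close> is concave and enters with the negative exponent \<open>1 - \<alpha>\<close>.\<close>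
  have hw: "?h ?w \<ge> (1 - \<theta>) * ?h x + \<theta> * ?h z"
  proof -
    have "(1 - \<theta>) * ?h x + \<theta> * ?h z = ?h ?w - \<theta> * (1 - \<theta>) * (x $ t - z $ t)\<^sup>2"
      by (simp add: power2_eq_square algebra_simps)
    then show ?thesis using \<theta> by simp
  qed
  have nw: "norm (drop_coord t ?w) \<le> (1 - \<theta>) * norm (drop_coord t x) + \<theta> * norm (drop_coord t z)"
    using norm_triangle_ineq[of "(1 - \<theta>) *\<^sub>R drop_coord t x" "\<theta> *\<^sub>R drop_coord t z"] \<theta>
    by (simp add: linear_add[OF linear_drop_coord] linear_scale[OF linear_drop_coord])
  have pos: "(1 - \<theta>) * ?h x + \<theta> * ?h z > 0" using \<theta> hx hz by (simp add: add_pos_pos)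
  have "pogorelov \<alpha> t ?w \<le> ((1 - \<theta>) * norm (drop_coord t x) + \<theta> * norm (drop_coord t z)) powr \<alpha>
      * ((1 - \<theta>) * ?h x + \<theta> * ?h z) powr (1 - \<alpha>)"
    unfolding pogorelov_def
    by (intro mult_mono powr_mono2 powr_mono2' nw hw pos) (use \<alpha> in auto)
  also have "\<dots> \<le> (1 - \<theta>) * pogorelov \<alpha> t x + \<theta> * pogorelov \<alpha> t z"
    unfolding pogorelov_def
    by (rule perspective_powr_convex) (use \<alpha> \<theta> hx hz in auto)
  finally show "pogorelov \<alpha> t ?w \<le> (1 - \<theta>) * pogorelov \<alpha> t x + \<theta> * pogorelov \<alpha> t z" .
qed (rule S(1))

section \<open>Exact regularity\<close>

lemma lipschitz_of_derivative_bound: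
  fixes F F' :: "real \<Rightarrow> real"
  assumes cont: "continuous_on {a..b} F"
    and D: "\<And>s. a < s \<Longrightarrow> s < b \<Longrightarrow> (F has_real_derivative F' s) (at s)"
    and L: "\<And>s. a < s \<Longrightarrow> s < b \<Longrightarrow> \<bar>F' s\<bar> \<le> L"
    and "p \<in> {a..b}" "q \<in> {a..b}"
  shows "\<bar>F p - F q\<bar> \<le> L * \<bar>p - q\<bar>"
proof -
  have less: "\<bar>F q - F p\<bar> \<le> L * \<bar>q - p\<bar>" if "p < q" "p \<in> {a..b}" "q \<in> {a..b}" for p q
  proof -
    have "continuous_on {p..q} F" using cont that by (auto elim: continuous_on_subset)
    moreover have D': "(F has_real_derivative F' s) (at s)" if "p < s" "s < q" for s
      using D[of s] that \<open>p \<in> {a..b}\<close> \<open>q \<in> {a..b}\<close> by simp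
    then have "F differentiable (at s)" if "p < s" "s < q" for s
      using that real_differentiable_def by blast
    ultimately obtain l z where z: "p < z" "z < q" "DERIV F z :> l" "F q - F p = (q - p) * l"
      using MVT[OF \<open>p < q\<close>] by blast
    then have "l = F' z" using D' DERIV_unique by blast
    then have "\<bar>l\<bar> \<le> L" using L[of z] z that by simp
    then show ?thesis using z(4) \<open>p < q\<close> by (simp add: abs_mult mult.commute mult_right_mono)
  qed
  show ?thesis
    using less[of p q] less[of q p] assms(4,5) by (cases p q rule: linorder_cases) (auto simp: abs_minus_commute)
qed

text \<open>A product of two bounded Lipschitz functions. The radius 1/2 keeps \<open>1 - \<tau>\<^sup>2\<close> above 3/4.\<close>

lemma pogorelov_lipschitz:
  assumes \<alpha>: "1 < \<alpha>"
  shows "C01_on (ball 0 (1 / 2)) (pogorelov \<alpha> t :: real ^ 'n \<Rightarrow> real)"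
proof -
  define B L where "B = (3 / 4 :: real) powr (1 - \<alpha>)" and "L = (\<alpha> - 1) * (3 / 4) powr (- \<alpha>)"
  have "\<bar>pogorelov \<alpha> t x - pogorelov \<alpha> t z\<bar> \<le> (L + B * \<alpha>) * norm (x - z)"
    if x: "x \<in> ball 0 (1 / 2)" and z: "z \<in> ball 0 (1 / 2)" for x z :: "real ^ 'n"
  proof -
    define A G where "A x = norm (drop_coord t x) powr \<alpha>" and "G x = (1 - (x $ t)\<^sup>2) powr (1 - \<alpha>)"
      for x :: "real ^ 'n"
    have n: "norm (drop_coord t y) \<in> {0..1}" if "y \<in> ball 0 (1 / 2)" for y :: "real ^ 'n"
      using norm_drop_coord_le[of t y] that by auto
    have c: "y $ t \<in> {- (1 / 2)..1 / 2}" if "y \<in> ball 0 (1 / 2)" for y :: "real ^ 'n"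
      using component_le_norm_cart[of y t] that by auto
    have q: "1 - s\<^sup>2 \<ge> 3 / 4" if "\<bar>s\<bar> \<le> 1 / 2" for s :: real
      using abs_le_square_iff[of s "1 / 2"] that by (simp add: power2_eq_square)
    have "\<bar>norm (drop_coord t x) powr \<alpha> - norm (drop_coord t z) powr \<alpha>\<bar>
        \<le> \<alpha> * \<bar>norm (drop_coord t x) - norm (drop_coord t z)\<bar>"
    proof (rule lipschitz_of_derivative_bound[OF _ _ _ n[OF x] n[OF z]])
      show "continuous_on {0..1} (\<lambda>s :: real. s powr \<alpha>)"
        using \<alpha> by (intro continuous_on_powr' continuous_intros) auto
      show "((\<lambda>s. s powr \<alpha>) has_real_derivative \<alpha> * s powr (\<alpha> - 1)) (at s)" if "0 < s" for s
        by (rule has_real_derivative_powr[OF that])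
      show "\<bar>\<alpha> * s powr (\<alpha> - 1)\<bar> \<le> \<alpha>" if "0 < s" "s < 1" for s
        using \<alpha> powr_le1[of "\<alpha> - 1" s] that by (simp add: abs_mult)
    qed
    also have "\<dots> \<le> \<alpha> * norm (x - z)"
    proof -
      have "\<bar>norm (drop_coord t x) - norm (drop_coord t z)\<bar> \<le> norm (drop_coord t (x - z))"
        using norm_triangle_ineq3 by (metis linear_diff linear_drop_coord)
      then show ?thesis using norm_drop_coord_le[of t "x - z"] \<alpha> by (intro mult_left_mono) auto
    qed
    finally have lipA: "\<bar>A x - A z\<bar> \<le> \<alpha> * norm (x - z)" by (simp add: A_def)
    have "\<bar>(1 - (x $ t)\<^sup>2) powr (1 - \<alpha>) - (1 - (z $ t)\<^sup>2) powr (1 - \<alpha>)\<bar> \<le> L * \<bar>x $ t - z $ t\<bar>"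
    proof (rule lipschitz_of_derivative_bound[OF _ _ _ c[OF x] c[OF z]])
      have D: "((\<lambda>s. (1 - s\<^sup>2) powr (1 - \<alpha>)) has_real_derivative (1 - \<alpha>) * (1 - s\<^sup>2) powr (- \<alpha>) * (- 2 * s)) (at s)"
        if "\<bar>s\<bar> \<le> 1 / 2" for s :: real
      proof -
        have "((\<lambda>s. 1 - s\<^sup>2) has_real_derivative - 2 * s) (at s)" by (auto intro!: derivative_eq_intros)
        moreover have "1 - s\<^sup>2 > 0" using q[OF that] by simp
        ultimately show ?thesis
          using DERIV_chain2[where g = "\<lambda>s. 1 - s\<^sup>2" and x = s and s = UNIV
              and f = "\<lambda>z. z powr (1 - \<alpha>)"] has_real_derivative_powr[of "1 - s\<^sup>2" "1 - \<alpha>"] by force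
      qed
      show "continuous_on {- (1 / 2)..1 / 2} (\<lambda>s :: real. (1 - s\<^sup>2) powr (1 - \<alpha>))"
        by (intro continuous_at_imp_continuous_on ballI DERIV_isCont[OF D]) auto
      show "((\<lambda>s. (1 - s\<^sup>2) powr (1 - \<alpha>)) has_real_derivative (1 - \<alpha>) * (1 - s\<^sup>2) powr (- \<alpha>) * (- 2 * s)) (at s)"
        if "- (1 / 2) < s" "s < 1 / 2" for s :: real
        by (rule D) (use that in auto)
      show "\<bar>(1 - \<alpha>) * (1 - s\<^sup>2) powr (- \<alpha>) * (- 2 * s)\<bar> \<le> L" if "- (1 / 2) < s" "s < 1 / 2" for s :: real
      proof -
        have s: "\<bar>s\<bar> \<le> 1 / 2" using that by auto
        have "\<bar>(1 - \<alpha>) * (1 - s\<^sup>2) powr (- \<alpha>) * (- 2 * s)\<bar> = ((\<alpha> - 1) * (1 - s\<^sup>2) powr (- \<alpha>)) * (2 * \<bar>s\<bar>)"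
          using \<alpha> by (simp add: abs_mult)
        also have "\<dots> \<le> ((\<alpha> - 1) * (3 / 4) powr (- \<alpha>)) * 1"
          using \<alpha> s q[OF s] by (intro mult_mono mult_left_mono powr_mono2') auto
        finally show ?thesis by (simp add: L_def)
      qed
    qed
    also have "\<dots> \<le> L * norm (x - z)"
      using component_le_norm_cart[of "x - z" t] \<alpha> by (intro mult_left_mono) (auto simp: L_def)
    finally have lipG: "\<bar>G x - G z\<bar> \<le> L * norm (x - z)" by (simp add: G_def)
    have A1: "\<bar>A x\<bar> \<le> 1" using n[OF x] \<alpha> by (simp add: A_def powr_le1)
    have GB: "\<bar>G z\<bar> \<le> B"
      using q[of "z $ t"] c[OF z] \<alpha> by (auto simp: G_def B_def intro!: powr_mono2')
    have "pogorelov \<alpha> t x - pogorelov \<alpha> t z = A x * (G x - G z) + G z * (A x - A z)"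
      by (simp add: pogorelov_def A_def G_def algebra_simps)
    also have "\<bar>\<dots>\<bar> \<le> \<bar>A x\<bar> * \<bar>G x - G z\<bar> + \<bar>G z\<bar> * \<bar>A x - A z\<bar>"
      by (metis abs_mult abs_triangle_ineq)
    also have "\<dots> \<le> 1 * (L * norm (x - z)) + B * (\<alpha> * norm (x - z))"
      using A1 GB lipA lipG \<alpha> by (intro add_mono mult_mono) (auto simp: B_def)
    finally show ?thesis by (simp add: algebra_simps)
  qed
  then have "(L + B * \<alpha>)-lipschitz_on (ball 0 (1 / 2)) (pogorelov \<alpha> t)"
    using \<alpha> by (auto simp: lipschitz_on_def dist_norm L_def B_def)
  then show ?thesis unfolding C01_on_def by blast
qed

text \<open>On a line through the origin orthogonal to the axis the gradient has the component \<open>\<alpha>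
s\<^bsup>\<alpha>-1\<^esup>\<close>, and it vanishes at 0. A Hoelder bound with \<open>\<beta> > \<alpha> - 1\<close> would give \<open>\<alpha> \<le> C s\<^bsup>\<beta>-\<alpha>+1\<^esup>\<close>, which
tends to 0.\<close>

lemma pogorelov_not_C1_holder:
  fixes t :: "'n::finite"
  assumes n: "CARD('n) \<ge> 2" and \<alpha>: "1 < \<alpha>" and \<beta>: "\<beta> > \<alpha> - 1" and r: "r > 0"
  shows "\<not> C1_holder_on \<beta> (ball 0 r) (pogorelov \<alpha> t)"
proof
  assume "C1_holder_on \<beta> (ball 0 r) (pogorelov \<alpha> t)"
  then obtain G C where G: "\<And>x. x \<in> ball 0 r \<Longrightarrow> GDERIV (pogorelov \<alpha> t) x :> G x"
    and C: "\<And>x y. x \<in> ball 0 r \<Longrightarrow> y \<in> ball 0 r \<Longrightarrow> norm (G x - G y) \<le> C * norm (x - y) powr \<beta>"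
    unfolding C1_holder_on_def by blast
  obtain a where a: "a \<noteq> t"
    using exists_other_index[OF n] by blast
  let ?e = "axis a 1 :: real ^ 'n"
  have z: "drop_coord t 0 = 0" by (simp add: drop_coord_def)
  have line: "pogorelov \<alpha> t (s *\<^sub>R ?e) = \<bar>s\<bar> powr \<alpha>" for s
    using pogorelov_on_axis(3)[OF z a, of \<alpha> s] by simp
  have D: "((\<lambda>s. \<bar>s\<bar> powr \<alpha>) has_real_derivative G (s *\<^sub>R ?e) \<bullet> ?e) (at s)" if "\<bar>s\<bar> < r" for s
  proof -
    have "(pogorelov \<alpha> t has_derivative (\<bullet>) (G (s *\<^sub>R ?e))) (at (s *\<^sub>R ?e))"
      using G[of "s *\<^sub>R ?e"] that unfolding gderiv_def by (simp add: inner_commute[of _ "G _"])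
    moreover have "((\<lambda>s. s *\<^sub>R ?e) has_derivative (\<lambda>d. d *\<^sub>R ?e)) (at s)"
      by (auto intro!: derivative_eq_intros)
    ultimately have "((\<lambda>s. pogorelov \<alpha> t (s *\<^sub>R ?e)) has_derivative (\<lambda>d. G (s *\<^sub>R ?e) \<bullet> (d *\<^sub>R ?e))) (at s)"
      by (rule has_derivative_compose[where f = "\<lambda>s. s *\<^sub>R ?e", rotated])
    then show ?thesis by (simp add: line has_field_derivative_def mult_commute_abs)
  qed
  have G0: "G 0 \<bullet> ?e = 0"
  proof (rule DERIV_local_min)
    show "((\<lambda>s. \<bar>s\<bar> powr \<alpha>) has_real_derivative G 0 \<bullet> ?e) (at 0)" using D[of 0] r by simp
  qed (use r in auto)
  have Gs: "G (s *\<^sub>R ?e) \<bullet> ?e = \<alpha> * s powr (\<alpha> - 1)" if s: "0 < s" "s < r" for s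
  proof (rule DERIV_unique)
    show "((\<lambda>s. \<bar>s\<bar> powr \<alpha>) has_real_derivative G (s *\<^sub>R ?e) \<bullet> ?e) (at s)" using D s by simp
    have "\<forall>\<^sub>F x in nhds s. \<bar>x\<bar> powr \<alpha> = x powr \<alpha>"
      using eventually_nhds_in_open[of "{0<..}" s] s by (auto elim: eventually_mono)
    then show "((\<lambda>s. \<bar>s\<bar> powr \<alpha>) has_real_derivative \<alpha> * s powr (\<alpha> - 1)) (at s)"
      using has_real_derivative_powr[OF s(1), of \<alpha>] by (subst DERIV_cong_ev) auto
  qed
  have "\<alpha> \<le> C * s powr (\<beta> - (\<alpha> - 1))" if s: "0 < s" "s < r" for s
  proof -
    have "\<alpha> * s powr (\<alpha> - 1) = (G (s *\<^sub>R ?e) - G 0) \<bullet> ?e"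
      using Gs[OF s] G0 by (simp add: inner_diff_left)
    also have "\<dots> \<le> norm (G (s *\<^sub>R ?e) - G 0)"
      using norm_cauchy_schwarz[of "G (s *\<^sub>R ?e) - G 0" ?e] by simp
    also have "\<dots> \<le> C * s powr \<beta>" using C[of "s *\<^sub>R ?e" 0] s r by simp
    also have "\<dots> = C * s powr (\<beta> - (\<alpha> - 1)) * s powr (\<alpha> - 1)" by (simp add: powr_add[symmetric])
    finally show ?thesis using s by simp
  qed
  then have "\<forall>\<^sub>F s in at_right 0. \<alpha> \<le> C * s powr (\<beta> - (\<alpha> - 1))"
    using r unfolding eventually_at_right_field by blast
  moreover have "((\<lambda>s. C * s powr (\<beta> - (\<alpha> - 1))) \<longlongrightarrow> C * 0 powr (\<beta> - (\<alpha> - 1))) (at_right 0)"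
    using \<beta> by (intro tendsto_intros) (auto simp: eventually_at_right_field intro: exI[of _ 1])
  ultimately have "\<alpha> \<le> C * 0 powr (\<beta> - (\<alpha> - 1))"
    by (intro tendsto_lowerbound) auto
  then show False using \<alpha> by simp
qed

section \<open>The example\<close>

theorem theorem1p2:
  fixes k :: nat
  assumes "CARD('n::finite) \<ge> 3"
    and "1 \<le> k" and "k \<le> CARD('n) - 3"
  shows "\<exists>r>0. \<exists>(f :: real ^ 'n \<Rightarrow> real) (u :: real ^ 'n \<Rightarrow> real).
    smooth_on (ball 0 r) f \<and> (\<forall>x\<in>ball 0 r. f x > 0) \<and>
    convex_on (ball 0 r) u \<and> viscosity_solution k f (ball 0 r) u \<and>
    C01_on (ball 0 r) u \<and>
    (\<forall>\<beta> > 1 - 2 / (real CARD('n) - real k). \<not> C1_holder_on \<beta> (ball 0 (r / 2)) u)"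
proof -
  obtain t :: 'n where True by blast
  define \<alpha> where "\<alpha> = 2 - 2 / real (CARD('n) - k)"
  have k: "k + 3 \<le> CARD('n)" using assms by linarith
  have "real (CARD('n) - k) \<ge> 3" using k by simp
  then have \<alpha>: "1 < \<alpha>" unfolding \<alpha>_def by (simp add: field_simps)
  have \<alpha>': "1 - 2 / (real CARD('n) - real k) = \<alpha> - 1" using k by (simp add: \<alpha>_def of_nat_diff)
  have sub: "ball 0 (1 / 2) \<subseteq> (ball 0 1 :: (real ^ 'n) set)" by (rule subset_ball) simp
  let ?f = "pogorelov_rhs k \<alpha> t" and ?u = "pogorelov \<alpha> t"
  have "smooth_on (ball 0 (1 / 2)) ?f"
    by (rule pogorelov_rhs_smooth[OF \<alpha> _ open_ball sub]) (use k in simp)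
  moreover have "\<forall>x\<in>ball 0 (1 / 2). ?f x > 0"
    by (intro ballI pogorelov_rhs_pos[OF \<alpha>] subsetD[OF sub]) (use k in auto)
  moreover have "convex_on (ball 0 (1 / 2)) ?u" using pogorelov_convex[OF _ convex_ball sub] \<alpha> by simp
  moreover have "viscosity_solution k ?f (ball 0 (1 / 2)) ?u"
    by (rule pogorelov_viscosity_solution[OF open_ball sub k \<alpha>_def])
  moreover have "C01_on (ball 0 (1 / 2)) ?u" by (rule pogorelov_lipschitz[OF \<alpha>])
  moreover have "\<forall>\<beta> > 1 - 2 / (real CARD('n) - real k). \<not> C1_holder_on \<beta> (ball 0 (1 / 2 / 2)) ?u"
    using pogorelov_not_C1_holder[OF _ \<alpha>, of _ "1 / 2 / 2" t] k unfolding \<alpha>' by simp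
  ultimately show ?thesis by (intro exI[of _ "1 / 2"] conjI exI[of _ ?f] exI[of _ ?u]) auto
qed

end
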